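(* Let $\varphi$ be a sentence of the monadic second-order language of graphs. Then for every $n\in\mathbb{N}$, the set $\{\,G\in\mathfrak{G}_n : \models_{\Omega(G)}\varphi\,\}$ is $\mathfrak{G}$-recognisable, where $\mathfrak{G}_n$ is the set of finite graphs of type $n$ and $\mathfrak{G}$ is the algebra of finite graphs.
   Context: Graphs. $\mathbb{N}$ contains $0$. A graph is $G=(V,E,\langle\_\rangle)$ with $V$ a finite nonempty set of vertices, $E$ a finite set of edges disjoint from $V$, and $\langle\_\rangle:E\to V^*$ assigning to every edge $e$ a nonempty finite word of vertices (its end points); $|e|$ denotes the length of $\langle e\rangle$. (So graphs are hypergraphs; parallel edges and repeated end points are allowed.) A graph of type $n\in\mathbb{N}$ is a graph together with a (not necessarily injective) map $t:\{1,\dots,n\}\to V$; the $t(i)$ are its terminals. $\mathfrak{G}_n$ is the set of graphs of type $n$; names of vertices and edges are immaterial, i.e. two typed graphs are identified if there are bijections of vertices and edges preserving the words $\langle e\rangle$ and the map $t$. Monadic second-order language of graphs. Formulas are built with $\neg,\wedge,\forall$ (other connectives and $\exists$ being abbreviations) from individual variables and set variables (unary predicate variables), with atomic formulas $\mathrm{vert}(x)$, $\mathrm{edge}(x)$, $x=y$, $X(x)$ and, for each $m\in\mathbb{N}$, $\mathrm{conn}_m(y,x_1,\dots,x_m)$; quantification is over individual variables and set variables. A sentence is a formula without free variables. In the structure $\Omega(G)$ induced by a graph $G$, individual variables range over $V\cup E$, set variables range over all subsets of $V$ and all subsets of $E$, $\mathrm{vert}$ and $\mathrm{edge}$ mean membership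 in $V$ and $E$, $X(x)$ means $x\in X$, and $\mathrm{conn}_m(y,x_1,\dots,x_m)$ holds iff $y\in E$ and $\langle y\rangle=x_1\cdots x_m$. (Terminals are not visible.) $\models_{\Omega(G)}\varphi$ means $\varphi$ is true in $\Omega(G)$. Algebras. A signature $\mathscr{S}=(\mathscr{T},\mathscr{F},\langle\_\rangle)$ consists of a set $\mathscr T$ of sorts, a set $\mathscr F$ of function symbols and a typing $\langle f\rangle=(t_1\cdots t_r,t)\in\mathscr{T}^*\times\mathscr{T}$ for $f\in\mathscr{F}$. An $\mathscr{S}$-algebra $\mathscr{A}=(\mathscr{C},\mathscr{O})$ consists of disjoint carrier sets $\mathscr{C}_t$ ($t\in\mathscr{T}$) and operations $\mathscr{O}_f:\mathscr{C}_{t_1}\times\dots\times\mathscr{C}_{t_r}\to\mathscr{C}_t$. An $\mathscr{S}$-algebra morphism is a sort-indexed family of maps of carriers commuting with all operations. An algebra is locally finite if each carrier is finite. For $t\in\mathscr T$, a subset $\mathscr{L}\subseteq\mathscr{C}_t$ is $\mathscr{A}$-recognisable if there are a locally finite $\mathscr{S}$-algebra $\mathscr{B}$ with carriers $\mathscr{D}_u$, an $\mathscr{S}$-algebra morphism $h=(h_u)_u:\mathscr{A}\to\mathscr{B}$ and a subset $\mathscr{M}\subseteq\mathscr{D}_t$ with $\mathscr{L}=h_t^{-1}(\mathscr{M})$. The algebra $\mathfrak{G}$. Its sorts are the elements of $\mathbb{N}$, its carriers are the $\mathfrak{G}_n$, and its operations are: (i) for all $n,m$, the disjoint sum $\oplus:\mathfrak{G}_n\times\mathfrak{G}_m\to\mathfrak{G}_{n+m}$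 (disjoint union, terminals of the first graph followed by those of the second); (ii) for every map $\sigma:\{1,\dots,n\}\to\{1,\dots,m\}$ the terminal redefinition $\mathfrak{G}_m\to\mathfrak{G}_n$, $(G,t)\mapsto(G,t\circ\sigma)$; (iii) for $a,b\in\{1,\dots,n\}$ the fusion $\mathfrak{G}_n\to\mathfrak{G}_n$ identifying the vertices $t(a)$ and $t(b)$ (all edges kept, words and terminal map transported along the identification; the identity if $t(a)=t(b)$); (iv) the constant $\mathfrak{v}\in\mathfrak{G}_1$ (one vertex, no edges, the vertex is the terminal) and for $n\ge1$ the constant $\mathfrak{e}_n\in\mathfrak{G}_n$ ($n$ distinct vertices $v_1,\dots,v_n$, one edge $e$ with $\langle e\rangle=v_1\cdots v_n$, $t(i)=v_i$). *)

theory Defs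
  imports "HOL-Library.FuncSet"
begin

section \<open>Graphs\<close>

record 'a hgraph =
  verts :: "'a set"
  edges :: "'a set"
  ends :: "'a \<Rightarrow> 'a list"

definition hgraph :: "('a, 'b) hgraph_scheme \<Rightarrow> bool" where
  "hgraph G \<longleftrightarrow> finite (verts G) \<and> verts G \<noteq> {} \<and> finite (edges G) \<and> verts G \<inter> edges G = {} \<and>
     (\<forall>e \<in> edges G. ends G e \<noteq> [] \<and> set (ends G e) \<subseteq> verts G)"

text \<open>Only the values of \<open>ends\<close> on edges and of \<open>trm\<close> on \<open>{1..rank}\<close> are meaningful; all notions
  below ignore the other values, in particular isomorphism does.\<close>

record 'a tgraph = "'a hgraph" +
  rank :: nat
  trm :: "nat \<Rightarrow> 'a"

definition tgraph :: "'a tgraph \<Rightarrow> bool" where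
  "tgraph G \<longleftrightarrow> hgraph G \<and> (\<forall>i \<in> {1..rank G}. trm G i \<in> verts G)"

definition iso :: "'a tgraph \<Rightarrow> 'b tgraph \<Rightarrow> bool" where
  "iso G H \<longleftrightarrow> rank G = rank H \<and>
     (\<exists>f g. bij_betw f (verts G) (verts H) \<and> bij_betw g (edges G) (edges H) \<and>
       (\<forall>e \<in> edges G. ends H (g e) = map f (ends G e)) \<and>
       (\<forall>i \<in> {1..rank G}. trm H i = f (trm G i)))"

text \<open>A graph up to renaming of vertices and edges is the class of all its copies with names in
  \<open>nat\<close>. As graphs are finite, every graph over any type has such a copy.\<close>

definition iso_class :: "'a tgraph \<Rightarrow> nat tgraph set" where
  "iso_class G = {H. tgraph H \<and> iso G H}"

type_synonym agraph = "nat tgraph set"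

definition agraphs :: "nat \<Rightarrow> agraph set" where
  "agraphs n = {iso_class G |G :: nat tgraph. tgraph G \<and> rank G = n}"

section \<open>Monadic second-order logic\<close>

text \<open>Individual variables and set variables are two separate families, each indexed by \<open>nat\<close>.
  \<open>Conn y [x\<^sub>1, \<dots>, x\<^sub>m]\<close> is the atomic formula for the predicate of index \<open>m\<close>.\<close>

datatype mso =
    Vert nat
  | Edge nat
  | Eq nat nat
  | Mem nat nat
  | Conn nat "nat list"
  | Neg mso
  | And mso mso
  | AllI nat mso
  | AllS nat mso

fun free_ind :: "mso \<Rightarrow> nat set" where
  "free_ind (Vert x) = {x}"
| "free_ind (Edge x) = {x}"
| "free_ind (Eq x y) = {x, y}"
| "free_ind (Mem X x) = {x}"
| "free_ind (Conn y xs) = insert y (set xs)"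
| "free_ind (Neg \<phi>) = free_ind \<phi>"
| "free_ind (And \<phi> \<psi>) = free_ind \<phi> \<union> free_ind \<psi>"
| "free_ind (AllI x \<phi>) = free_ind \<phi> - {x}"
| "free_ind (AllS X \<phi>) = free_ind \<phi>"

fun free_set :: "mso \<Rightarrow> nat set" where
  "free_set (Vert x) = {}"
| "free_set (Edge x) = {}"
| "free_set (Eq x y) = {}"
| "free_set (Mem X x) = {X}"
| "free_set (Conn y xs) = {}"
| "free_set (Neg \<phi>) = free_set \<phi>"
| "free_set (And \<phi> \<psi>) = free_set \<phi> \<union> free_set \<psi>"
| "free_set (AllI x \<phi>) = free_set \<phi>"
| "free_set (AllS X \<phi>) = free_set \<phi> - {X}"

definition sentence :: "mso \<Rightarrow> bool" where
  "sentence \<phi> \<longleftrightarrow> free_ind \<phi> = {} \<and> free_set \<phi> = {}"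

definition ind_dom :: "('a, 'b) hgraph_scheme \<Rightarrow> 'a set" where
  "ind_dom G = verts G \<union> edges G"

text \<open>Values of set variables are sets of vertices or sets of edges, never mixed ones.\<close>

definition set_dom :: "('a, 'b) hgraph_scheme \<Rightarrow> 'a set set" where
  "set_dom G = Pow (verts G) \<union> Pow (edges G)"

fun sat :: "('a, 'b) hgraph_scheme \<Rightarrow> (nat \<Rightarrow> 'a) \<Rightarrow> (nat \<Rightarrow> 'a set) \<Rightarrow> mso \<Rightarrow> bool" where
  "sat G i s (Vert x) \<longleftrightarrow> i x \<in> verts G"
| "sat G i s (Edge x) \<longleftrightarrow> i x \<in> edges G"
| "sat G i s (Eq x y) \<longleftrightarrow> i x = i y"
| "sat G i s (Mem X x) \<longleftrightarrow> i x \<in> s X"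
| "sat G i s (Conn y xs) \<longleftrightarrow> i y \<in> edges G \<and> ends G (i y) = map i xs"
| "sat G i s (Neg \<phi>) \<longleftrightarrow> \<not> sat G i s \<phi>"
| "sat G i s (And \<phi> \<psi>) \<longleftrightarrow> sat G i s \<phi> \<and> sat G i s \<psi>"
| "sat G i s (AllI x \<phi>) \<longleftrightarrow> (\<forall>a \<in> ind_dom G. sat G (i(x := a)) s \<phi>)"
| "sat G i s (AllS X \<phi>) \<longleftrightarrow> (\<forall>A \<in> set_dom G. sat G i (s(X := A)) \<phi>)"

definition models :: "('a, 'b) hgraph_scheme \<Rightarrow> mso \<Rightarrow> bool" where
  "models G \<phi> \<longleftrightarrow> (\<forall>i s. range i \<subseteq> ind_dom G \<and> range s \<subseteq> set_dom G \<longrightarrow> sat G i s \<phi>)"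

text \<open>Truth is invariant under isomorphism (see \<open>models_iso\<close> below), so all members of a class agree.\<close>

definition amodels :: "agraph \<Rightarrow> mso \<Rightarrow> bool" where
  "amodels X \<phi> \<longleftrightarrow> (\<forall>G \<in> X. models G \<phi>)"

section \<open>Many-sorted algebras\<close>

record ('s, 'f) signature =
  sorts :: "'s set"
  funs :: "'f set"
  typing :: "'f \<Rightarrow> 's list \<times> 's"

abbreviation dom_sorts :: "('s, 'f) signature \<Rightarrow> 'f \<Rightarrow> 's list" where
  "dom_sorts S f \<equiv> fst (typing S f)"

abbreviation cod_sort :: "('s, 'f) signature \<Rightarrow> 'f \<Rightarrow> 's" where
  "cod_sort S f \<equiv> snd (typing S f)"

definition signature :: "('s, 'f) signature \<Rightarrow> bool" where
  "signature S \<longleftrightarrow> (\<forall>f \<in> funs S. set (dom_sorts S f) \<subseteq> sorts S \<and> cod_sort S f \<in> sorts S)"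

record ('s, 'f, 'a) algebra =
  carrier :: "'s \<Rightarrow> 'a set"
  opn :: "'f \<Rightarrow> 'a list \<Rightarrow> 'a"

definition args :: "('s, 'f) signature \<Rightarrow> ('s, 'f, 'a) algebra \<Rightarrow> 'f \<Rightarrow> 'a list set" where
  "args S A f = {xs. list_all2 (\<lambda>x t. x \<in> carrier A t) xs (dom_sorts S f)}"

definition algebra :: "('s, 'f) signature \<Rightarrow> ('s, 'f, 'a) algebra \<Rightarrow> bool" where
  "algebra S A \<longleftrightarrow> signature S \<and>
     (\<forall>t \<in> sorts S. \<forall>u \<in> sorts S. t \<noteq> u \<longrightarrow> carrier A t \<inter> carrier A u = {}) \<and>
     (\<forall>f \<in> funs S. \<forall>xs \<in> args S A f. opn A f xs \<in> carrier A (cod_sort S f))"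

definition morphism ::
    "('s, 'f) signature \<Rightarrow> ('s, 'f, 'a) algebra \<Rightarrow> ('s, 'f, 'b) algebra \<Rightarrow> ('s \<Rightarrow> 'a \<Rightarrow> 'b) \<Rightarrow> bool" where
  "morphism S A B h \<longleftrightarrow>
     (\<forall>t \<in> sorts S. h t \<in> carrier A t \<rightarrow> carrier B t) \<and>
     (\<forall>f \<in> funs S. \<forall>xs \<in> args S A f.
        h (cod_sort S f) (opn A f xs) = opn B f (map2 h (dom_sorts S f) xs))"

definition locally_finite :: "('s, 'f) signature \<Rightarrow> ('s, 'f, 'a) algebra \<Rightarrow> bool" where
  "locally_finite S A \<longleftrightarrow> (\<forall>t \<in> sorts S. finite (carrier A t))"

text \<open>The elements of the locally finite algebra are taken from \<open>'s \<times> nat\<close>. This is no restriction: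
  every locally finite algebra is isomorphic to one with \<open>carrier t \<subseteq> {t} \<times> UNIV\<close>
  (see \<open>recognisableI\<close> below, where the algebra is over an arbitrary type).\<close>

definition recognisable ::
    "('s, 'f) signature \<Rightarrow> ('s, 'f, 'a) algebra \<Rightarrow> 's \<Rightarrow> 'a set \<Rightarrow> bool" where
  "recognisable S A t L \<longleftrightarrow>
     (\<exists>(B :: ('s, 'f, 's \<times> nat) algebra) h M.
        algebra S B \<and> locally_finite S B \<and> morphism S A B h \<and>
        M \<subseteq> carrier B t \<and> L = {x \<in> carrier A t. h t x \<in> M})"

section \<open>The algebra of graphs\<close>

definition disj_sum :: "'a tgraph \<Rightarrow> 'b tgraph \<Rightarrow> ('a + 'b) tgraph" where
  "disj_sum G H =
    \<lparr>verts = verts G <+> verts H, edges = edges G <+> edges H,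
     ends = case_sum (\<lambda>e. map Inl (ends G e)) (\<lambda>e. map Inr (ends H e)),
     rank = rank G + rank H,
     trm = (\<lambda>i. if i \<le> rank G then Inl (trm G i) else Inr (trm H (i - rank G)))\<rparr>"

definition redefine :: "nat \<Rightarrow> (nat \<Rightarrow> nat) \<Rightarrow> 'a tgraph \<Rightarrow> 'a tgraph" where
  "redefine n \<sigma> G = G\<lparr>rank := n, trm := trm G \<circ> \<sigma>\<rparr>"

definition fuse :: "nat \<Rightarrow> nat \<Rightarrow> 'a tgraph \<Rightarrow> 'a tgraph" where
  "fuse a b G = (let q = (\<lambda>v. if v = trm G b then trm G a else v) in
     G\<lparr>verts := q ` verts G, ends := map q \<circ> ends G, trm := q \<circ> trm G\<rparr>)"

definition vertex_graph :: "nat tgraph" where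
  "vertex_graph = \<lparr>verts = {0}, edges = {}, ends = (\<lambda>_. []), rank = 1, trm = (\<lambda>_. 0)\<rparr>"

definition edge_graph :: "nat \<Rightarrow> nat tgraph" where
  "edge_graph n =
    \<lparr>verts = {1..n}, edges = {0}, ends = (\<lambda>_. [1..<Suc n]), rank = n, trm = (\<lambda>i. i)\<rparr>"

datatype gsym =
    Sum nat nat
  | Redef nat nat "nat \<Rightarrow> nat"
  | Fuse nat nat nat
  | VertC
  | EdgeC nat

text \<open>In \<open>Redef n m \<sigma>\<close> the map \<open>\<sigma>\<close> is required to be extensional, so that there is exactly one symbol
  for each map from \<open>{1..n}\<close> to \<open>{1..m}\<close>.\<close>

definition graph_sig :: "(nat, gsym) signature" where
  "graph_sig =
    \<lparr>sorts = UNIV,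
     funs = {Sum n m |n m. True} \<union> {Redef n m \<sigma> |n m \<sigma>. \<sigma> \<in> {1..n} \<rightarrow>\<^sub>E {1..m}} \<union>
       {Fuse n a b |n a b. a \<in> {1..n} \<and> b \<in> {1..n}} \<union> {VertC} \<union> {EdgeC n |n. n \<ge> 1},
     typing = (\<lambda>f. case f of
         Sum n m \<Rightarrow> ([n, m], n + m)
       | Redef n m \<sigma> \<Rightarrow> ([m], n)
       | Fuse n a b \<Rightarrow> ([n], n)
       | VertC \<Rightarrow> ([], 1)
       | EdgeC n \<Rightarrow> ([], n))\<rparr>"

text \<open>Each operation acts on classes through their members; each of the unions below is a union of
  copies of a single class (see \<open>gop_iso_class\<close> below).\<close>

fun gop :: "gsym \<Rightarrow> agraph list \<Rightarrow> agraph" where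
  "gop (Sum n m) [X, Y] = (\<Union>G \<in> X. \<Union>H \<in> Y. iso_class (disj_sum G H))"
| "gop (Redef n m \<sigma>) [X] = (\<Union>G \<in> X. iso_class (redefine n \<sigma> G))"
| "gop (Fuse n a b) [X] = (\<Union>G \<in> X. iso_class (fuse a b G))"
| "gop VertC [] = iso_class vertex_graph"
| "gop (EdgeC n) [] = iso_class (edge_graph n)"

definition graph_alg :: "(nat, gsym, agraph) algebra" where
  "graph_alg = \<lparr>carrier = agraphs, opn = gop\<rparr>"

section \<open>Adequacy\<close>

lemma isoI:
  assumes "rank G = rank H" "bij_betw f (verts G) (verts H)" "bij_betw g (edges G) (edges H)"
    and "\<And>e. e \<in> edges G \<Longrightarrow> ends H (g e) = map f (ends G e)"
    and "\<And>i. i \<in> {1..rank G} \<Longrightarrow> trm H i = f (trm G i)"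
  shows "iso G H"
  unfolding iso_def using assms by blast

lemma tgraphD:
  assumes "tgraph G"
  shows "finite (verts G)" "verts G \<noteq> {}" "finite (edges G)" "verts G \<inter> edges G = {}"
    "e \<in> edges G \<Longrightarrow> ends G e \<noteq> []" "e \<in> edges G \<Longrightarrow> v \<in> set (ends G e) \<Longrightarrow> v \<in> verts G"
    "1 \<le> i \<Longrightarrow> i \<le> rank G \<Longrightarrow> trm G i \<in> verts G"
  using assms unfolding tgraph_def hgraph_def by auto

lemma iso_refl: "iso G G"
  by (rule isoI[where f = id and g = id]) auto

lemma iso_sym:
  assumes "tgraph G" "iso G H" shows "iso H G"
proof -
  from assms(2) obtain f g where *[rule_format]: "rank H = rank G" "bij_betw f (verts G) (verts H)"
    "bij_betw g (edges G) (edges H)"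
    "\<forall>e \<in> edges G. ends H (g e) = map f (ends G e)"
    "\<forall>i \<in> {1..rank G}. trm H i = f (trm G i)" unfolding iso_def by metis
  let ?f = "inv_into (verts G) f" and ?g = "inv_into (edges G) g"
  have ff: "?f (f v) = v" if "v \<in> verts G" for v
    using *(2) that by (simp add: bij_betw_def)
  have gg: "\<exists>e' \<in> edges G. g e' = e \<and> ?g e = e'" if "e \<in> edges H" for e
    using *(3) that by (metis bij_betw_imp_surj_on f_inv_into_f inv_into_into)
  show ?thesis
  proof (rule isoI[where f = ?f and g = ?g])
    show "bij_betw ?f (verts H) (verts G)" "bij_betw ?g (edges H) (edges G)"
      using *(2,3) by (auto intro: bij_betw_inv_into)
    show "ends G (?g e) = map ?f (ends H e)" if e: "e \<in> edges H" for e
    proof -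
      obtain e' where e': "e' \<in> edges G" "g e' = e" "?g e = e'" using gg[OF e] by blast
      have "map ?f (ends H e) = map (?f \<circ> f) (ends G e')" using *(4)[OF e'(1)] e'(2) by simp
      also have "\<dots> = ends G e'"
        by (rule map_idI) (use ff tgraphD(6)[OF assms(1) e'(1)] in auto)
      finally show ?thesis using e' by simp
    qed
    show "trm G i = ?f (trm H i)" if "i \<in> {1..rank H}" for i
      using that *(1) *(5)[of i] ff tgraphD(7)[OF assms(1), of i] by simp
  qed (simp add: *(1))
qed

lemma iso_trans:
  assumes "iso G H" "iso H K" shows "iso G K"
proof -
  from assms(1) obtain f g where 1[rule_format]: "rank H = rank G" "bij_betw f (verts G) (verts H)"
    "bij_betw g (edges G) (edges H)"
    "\<forall>e \<in> edges G. ends H (g e) = map f (ends G e)"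
    "\<forall>i \<in> {1..rank G}. trm H i = f (trm G i)" unfolding iso_def by metis
  from assms(2) obtain f' g' where 2[rule_format]: "rank K = rank H" "bij_betw f' (verts H) (verts K)"
    "bij_betw g' (edges H) (edges K)"
    "\<forall>e \<in> edges H. ends K (g' e) = map f' (ends H e)"
    "\<forall>i \<in> {1..rank H}. trm K i = f' (trm H i)" unfolding iso_def by metis
  show ?thesis
  proof (rule isoI[where f = "f' \<circ> f" and g = "g' \<circ> g"])
    show "bij_betw (f' \<circ> f) (verts G) (verts K)" "bij_betw (g' \<circ> g) (edges G) (edges K)"
      using 1(2,3) 2(2,3) by (auto intro: bij_betw_trans)
    show "ends K ((g' \<circ> g) e) = map (f' \<circ> f) (ends G e)" if "e \<in> edges G" for e
      using that 1(4) 2(4) bij_betwE[OF 1(3)] by simp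
    show "trm K i = (f' \<circ> f) (trm G i)" if "i \<in> {1..rank G}" for i
      using that 1(1) 1(5)[of i] 2(5)[of i] by simp
  qed (simp add: 1(1) 2(1))
qed

lemma iso_class_eq:
  assumes "tgraph G" "iso G H" shows "iso_class G = iso_class H"
proof -
  have "iso G K \<longleftrightarrow> iso H K" for K :: "nat tgraph"
    using iso_trans[OF assms(2), of K] iso_trans[OF iso_sym[OF assms], of K] by auto
  then show ?thesis by (simp add: iso_class_def)
qed

lemma ex_nat_copy:
  assumes "tgraph (G :: 'a tgraph)" shows "\<exists>H :: nat tgraph. tgraph H \<and> iso G H"
proof -
  have "finite (verts G \<union> edges G)" using tgraphD[OF assms] by simp
  then obtain h :: "'a \<Rightarrow> nat" where h: "inj_on h (verts G \<union> edges G)"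
    using finite_imp_inj_to_nat_seg by metis
  let ?g = "inv_into (edges G) h"
  let ?H = "\<lparr>verts = h ` verts G, edges = h ` edges G, ends = (\<lambda>e. map h (ends G (?g e))),
    rank = rank G, trm = h \<circ> trm G\<rparr>"
  have he: "inj_on h (edges G)" "inj_on h (verts G)" using h by (auto simp: inj_on_def)
  have "iso G ?H"
    by (rule isoI[where f = h and g = h]) (use he in \<open>auto simp: bij_betw_def\<close>)
  moreover have "h ` verts G \<inter> h ` edges G = {}"
    using tgraphD(4)[OF assms] h by (auto simp: inj_on_def)
  then have "tgraph ?H"
    unfolding tgraph_def hgraph_def using tgraphD[OF assms] he by auto
  ultimately show ?thesis by blast
qed

lemma iso_class_in_agraphs:
  assumes "tgraph G" "rank G = n" shows "iso_class G \<in> agraphs n"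
proof -
  obtain H :: "nat tgraph" where H: "tgraph H" "iso G H" using ex_nat_copy[OF assms(1)] by blast
  then have "rank H = n" using assms by (simp add: iso_def)
  then show ?thesis unfolding agraphs_def using H iso_class_eq[OF assms(1) H(2)] by blast
qed

lemma tgraphI:
  assumes "finite (verts G)" "verts G \<noteq> {}" "finite (edges G)" "verts G \<inter> edges G = {}"
    and "\<And>e. e \<in> edges G \<Longrightarrow> ends G e \<noteq> [] \<and> set (ends G e) \<subseteq> verts G"
    and "\<And>i. 1 \<le> i \<Longrightarrow> i \<le> rank G \<Longrightarrow> trm G i \<in> verts G"
  shows "tgraph G"
  using assms by (simp add: tgraph_def hgraph_def)

lemma tgraph_disj_sum:
  assumes "tgraph G" "tgraph H" shows "tgraph (disj_sum G H)"
proof (rule tgraphI)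
  note G = tgraphD[OF assms(1)] and H = tgraphD[OF assms(2)]
  show "finite (verts (disj_sum G H))" "finite (edges (disj_sum G H))" "verts (disj_sum G H) \<noteq> {}"
    using G(1-3) H(1,3) by (auto simp: disj_sum_def)
  show "verts (disj_sum G H) \<inter> edges (disj_sum G H) = {}"
    using G(4) H(4) by (auto simp: disj_sum_def)
  show "ends (disj_sum G H) e \<noteq> [] \<and> set (ends (disj_sum G H) e) \<subseteq> verts (disj_sum G H)"
    if "e \<in> edges (disj_sum G H)" for e
    using that G(5,6) H(5,6) by (cases e) (auto simp: disj_sum_def)
  show "trm (disj_sum G H) i \<in> verts (disj_sum G H)" if "1 \<le> i" "i \<le> rank (disj_sum G H)" for i
  proof (cases "i \<le> rank G")
    case True
    then show ?thesis using that(1) G(7)[of i] by (auto simp: disj_sum_def)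
  next
    case False
    then show ?thesis using that(2) H(7)[of "i - rank G"] by (auto simp: disj_sum_def)
  qed
qed

lemma tgraph_redefine:
  "tgraph G \<Longrightarrow> \<sigma> \<in> {1..n} \<rightarrow> {1..rank G} \<Longrightarrow> tgraph (redefine n \<sigma> G)"
  unfolding tgraph_def hgraph_def redefine_def by (auto simp: Pi_def)

lemma tgraph_fuse:
  assumes "tgraph G" "a \<in> {1..rank G}" "b \<in> {1..rank G}" shows "tgraph (fuse a b G)"
  using assms unfolding tgraph_def hgraph_def fuse_def Let_def by auto

lemma tgraph_vertex_graph: "tgraph vertex_graph"
  unfolding tgraph_def hgraph_def vertex_graph_def by auto

lemma tgraph_edge_graph: "n \<ge> 1 \<Longrightarrow> tgraph (edge_graph n)"
  unfolding tgraph_def hgraph_def edge_graph_def by auto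

lemma rank_simps [simp]:
  "rank (disj_sum G H) = rank G + rank H" "rank (redefine n \<sigma> G) = n"
  "rank (fuse a b G) = rank G" "rank vertex_graph = 1" "rank (edge_graph n) = n"
  by (simp_all add: disj_sum_def redefine_def fuse_def Let_def vertex_graph_def edge_graph_def)

lemma bij_betw_map_sum:
  assumes "bij_betw f A B" "bij_betw f' A' B'"
  shows "bij_betw (map_sum f f') (A <+> A') (B <+> B')"
proof -
  have "inj_on (map_sum f f') (A <+> A')"
    using assms by (auto simp: bij_betw_def intro!: inj_onI dest: inj_onD)
  moreover have "map_sum f f' ` (A <+> A') = (f ` A) <+> (f' ` A')"
    unfolding Plus_def by (simp add: image_Un image_image)
  ultimately show ?thesis using assms by (simp add: bij_betw_def)
qed

lemma iso_disj_sum: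
  assumes "iso G G'" "iso H H'" shows "iso (disj_sum G H) (disj_sum G' H')"
proof -
  from assms(1) obtain f g where 1[rule_format]: "rank G' = rank G" "bij_betw f (verts G) (verts G')"
    "bij_betw g (edges G) (edges G')"
    "\<forall>e \<in> edges G. ends G' (g e) = map f (ends G e)"
    "\<forall>i \<in> {1..rank G}. trm G' i = f (trm G i)" unfolding iso_def by metis
  from assms(2) obtain f' g' where 2[rule_format]: "rank H' = rank H" "bij_betw f' (verts H) (verts H')"
    "bij_betw g' (edges H) (edges H')"
    "\<forall>e \<in> edges H. ends H' (g' e) = map f' (ends H e)"
    "\<forall>i \<in> {1..rank H}. trm H' i = f' (trm H i)" unfolding iso_def by metis
  show ?thesis
  proof (rule isoI[where f = "map_sum f f'" and g = "map_sum g g'"])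
    show "rank (disj_sum G H) = rank (disj_sum G' H')" using 1(1) 2(1) by simp
    show "bij_betw (map_sum f f') (verts (disj_sum G H)) (verts (disj_sum G' H'))"
      "bij_betw (map_sum g g') (edges (disj_sum G H)) (edges (disj_sum G' H'))"
      using bij_betw_map_sum[OF 1(2) 2(2)] bij_betw_map_sum[OF 1(3) 2(3)]
      by (simp_all add: disj_sum_def)
    show "ends (disj_sum G' H') (map_sum g g' e) = map (map_sum f f') (ends (disj_sum G H) e)"
      if "e \<in> edges (disj_sum G H)" for e
      using that by (cases e) (auto simp: disj_sum_def 1(4) 2(4))
    show "trm (disj_sum G' H') i = map_sum f f' (trm (disj_sum G H) i)"
      if "i \<in> {1..rank (disj_sum G H)}" for i
    proof (cases "i \<le> rank G")
      case True
      then show ?thesis using that 1(1) 1(5)[of i] by (simp add: disj_sum_def)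
    next
      case False
      then have "i - rank G \<in> {1..rank H}" using that by auto
      then show ?thesis using False 1(1) 2(5)[of "i - rank G"] by (simp add: disj_sum_def)
    qed
  qed
qed

lemma iso_redefine:
  assumes "iso G H" "\<sigma> \<in> {1..n} \<rightarrow> {1..rank G}"
  shows "iso (redefine n \<sigma> G) (redefine n \<sigma> H)"
proof -
  from assms(1) obtain f g where 1[rule_format]: "rank H = rank G" "bij_betw f (verts G) (verts H)"
    "bij_betw g (edges G) (edges H)"
    "\<forall>e \<in> edges G. ends H (g e) = map f (ends G e)"
    "\<forall>i \<in> {1..rank G}. trm H i = f (trm G i)" unfolding iso_def by metis
  show ?thesis
    by (rule isoI[where f = f and g = g]) (use 1 assms(2) in \<open>auto simp: redefine_def Pi_def\<close>)
qed

lemma fuse_sel: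
  "verts (fuse a b G) = (\<lambda>v. if v = trm G b then trm G a else v) ` verts G"
  "edges (fuse a b G) = edges G"
  "ends (fuse a b G) e = map (\<lambda>v. if v = trm G b then trm G a else v) (ends G e)"
  "trm (fuse a b G) i = (\<lambda>v. if v = trm G b then trm G a else v) (trm G i)"
  by (simp_all add: fuse_def Let_def)

lemma iso_fuse:
  assumes "tgraph G" "iso G H" "a \<in> {1..rank G}" "b \<in> {1..rank G}"
  shows "iso (fuse a b G) (fuse a b H)"
proof -
  from assms(2) obtain f g where 1[rule_format]: "rank H = rank G" "bij_betw f (verts G) (verts H)"
    "bij_betw g (edges G) (edges H)"
    "\<forall>e \<in> edges G. ends H (g e) = map f (ends G e)"
    "\<forall>i \<in> {1..rank G}. trm H i = f (trm G i)" unfolding iso_def by metis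
  let ?q = "\<lambda>v. if v = trm G b then trm G a else v"
  let ?r = "\<lambda>v. if v = trm H b then trm H a else v"
  have ab: "trm G a \<in> verts G" "trm G b \<in> verts G" using assms tgraphD(7)[OF assms(1)] by auto
  have inj: "inj_on f (verts G)" and im: "f ` verts G = verts H" using 1(2) by (auto simp: bij_betw_def)
  have q: "?r (f v) = f (?q v)" if "v \<in> verts G" for v
    using that ab inj 1(5)[OF assms(3)] 1(5)[OF assms(4)] by (auto dest: inj_onD)
  have sub: "?q ` verts G \<subseteq> verts G" using ab by auto
  have "f ` ?q ` verts G = ?r ` verts H"
    unfolding im[symmetric] image_image using q by (intro image_cong) auto
  then have bij: "bij_betw f (?q ` verts G) (?r ` verts H)"
    using inj_on_subset[OF inj sub] by (simp add: bij_betw_def)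
  have e: "map ?r (ends H (g e)) = map f (map ?q (ends G e))" if "e \<in> edges G" for e
  proof -
    have "map ?r (ends H (g e)) = map (\<lambda>v. ?r (f v)) (ends G e)" using 1(4)[OF that] by simp
    also have "\<dots> = map (\<lambda>v. f (?q v)) (ends G e)"
      by (rule map_cong[OF refl]) (use q tgraphD(6)[OF assms(1) that] in blast)
    finally show ?thesis by simp
  qed
  have t: "?r (trm H i) = f (?q (trm G i))" if "i \<in> {1..rank G}" for i
  proof -
    have "trm G i \<in> verts G" using that tgraphD(7)[OF assms(1), of i] by simp
    then show ?thesis unfolding 1(5)[OF that] by (rule q)
  qed
  show ?thesis
  proof (rule isoI[where f = f and g = g])
    show "rank (fuse a b G) = rank (fuse a b H)" using 1(1) by simp
    show "bij_betw f (verts (fuse a b G)) (verts (fuse a b H))"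
      using bij by (simp only: fuse_sel)
    show "bij_betw g (edges (fuse a b G)) (edges (fuse a b H))"
      using 1(3) by (simp only: fuse_sel)
    show "ends (fuse a b H) (g e) = map f (ends (fuse a b G) e)" if "e \<in> edges (fuse a b G)" for e
    proof -
      have "e \<in> edges G" using that by (simp only: fuse_sel)
      from e[OF this] show ?thesis by (simp only: fuse_sel o_apply)
    qed
    show "trm (fuse a b H) i = f (trm (fuse a b G) i)" if "i \<in> {1..rank (fuse a b G)}" for i
    proof -
      have "i \<in> {1..rank G}" using that by simp
      from t[OF this] show ?thesis by (simp only: fuse_sel o_apply)
    qed
  qed
qed

lemma UN_iso_class:
  assumes "tgraph G" and "\<And>H. tgraph H \<Longrightarrow> iso G H \<Longrightarrow> F H = C"
  shows "(\<Union>H \<in> iso_class G. F H) = C"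
proof -
  have "iso_class G \<noteq> {}" using ex_nat_copy[OF assms(1)] by (auto simp: iso_class_def)
  moreover have "\<And>H. H \<in> iso_class G \<Longrightarrow> F H = C" using assms(2) by (auto simp: iso_class_def)
  ultimately show ?thesis by auto
qed

theorem gop_iso_class:
  assumes "tgraph G"
  shows "tgraph H \<Longrightarrow> gop (Sum n m) [iso_class G, iso_class H] = iso_class (disj_sum G H)"
    and "\<sigma> \<in> {1..n} \<rightarrow> {1..rank G} \<Longrightarrow> gop (Redef n m \<sigma>) [iso_class G] = iso_class (redefine n \<sigma> G)"
    and "a \<in> {1..rank G} \<Longrightarrow> b \<in> {1..rank G} \<Longrightarrow>
      gop (Fuse n a b) [iso_class G] = iso_class (fuse a b G)"
proof -
  show "gop (Sum n m) [iso_class G, iso_class H] = iso_class (disj_sum G H)" if "tgraph H"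
    unfolding gop.simps using assms that
    by (intro UN_iso_class) (auto intro!: iso_class_eq[symmetric] tgraph_disj_sum iso_disj_sum)
  show "gop (Redef n m \<sigma>) [iso_class G] = iso_class (redefine n \<sigma> G)"
    if "\<sigma> \<in> {1..n} \<rightarrow> {1..rank G}"
    unfolding gop.simps using assms that
    by (intro UN_iso_class iso_class_eq[symmetric] tgraph_redefine iso_redefine)
  show "gop (Fuse n a b) [iso_class G] = iso_class (fuse a b G)"
    if "a \<in> {1..rank G}" "b \<in> {1..rank G}"
    unfolding gop.simps using assms that
    by (intro UN_iso_class iso_class_eq[symmetric] tgraph_fuse iso_fuse)
qed

lemma agraphs_disjoint:
  assumes "n \<noteq> m" shows "agraphs n \<inter> agraphs m = {}"
proof (rule equals0I)
  fix X assume "X \<in> agraphs n \<inter> agraphs m"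
  then obtain G H :: "nat tgraph" where GH: "tgraph G" "rank G = n" "X = iso_class G"
    "rank H = m" "X = iso_class H" by (auto simp: agraphs_def)
  then have "G \<in> iso_class H" using iso_refl[of G] by (auto simp: iso_class_def)
  then show False using GH assms by (auto simp: iso_class_def iso_def)
qed

theorem algebra_graph_alg: "algebra graph_sig graph_alg"
proof -
  have sig: "signature graph_sig" by (simp add: signature_def graph_sig_def)
  have "gop f xs \<in> agraphs (cod_sort graph_sig f)"
    if f: "f \<in> funs graph_sig" and xs: "xs \<in> args graph_sig graph_alg f" for f xs
  proof (cases f)
    case (Sum n m)
    then obtain X Y where "xs = [X, Y]" "X \<in> agraphs n" "Y \<in> agraphs m"
      using xs by (auto simp: args_def graph_sig_def graph_alg_def list_all2_Cons2)
    then obtain G H :: "nat tgraph" where "xs = [iso_class G, iso_class H]"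
      "tgraph G" "tgraph H" "rank G = n" "rank H = m" by (auto simp: agraphs_def)
    then show ?thesis using Sum
      by (simp add: gop_iso_class graph_sig_def iso_class_in_agraphs tgraph_disj_sum del: gop.simps)
  next
    case (Redef n m \<sigma>)
    then obtain G :: "nat tgraph" where "xs = [iso_class G]" "tgraph G" "rank G = m"
      using xs by (auto simp: args_def graph_sig_def graph_alg_def list_all2_Cons2 agraphs_def)
    moreover have "\<sigma> \<in> {1..n} \<rightarrow> {1..m}" using f Redef by (auto simp: graph_sig_def PiE_def)
    ultimately show ?thesis using Redef
      by (simp add: gop_iso_class graph_sig_def iso_class_in_agraphs tgraph_redefine del: gop.simps)
  next
    case (Fuse n a b)
    then obtain G :: "nat tgraph" where "xs = [iso_class G]" "tgraph G" "rank G = n"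
      using xs by (auto simp: args_def graph_sig_def graph_alg_def list_all2_Cons2 agraphs_def)
    moreover have "a \<in> {1..n}" "b \<in> {1..n}" using f Fuse by (auto simp: graph_sig_def)
    ultimately show ?thesis using Fuse
      by (simp add: gop_iso_class graph_sig_def iso_class_in_agraphs tgraph_fuse del: gop.simps)
  next
    case VertC
    then show ?thesis using xs
      by (simp add: args_def graph_sig_def iso_class_in_agraphs tgraph_vertex_graph)
  next
    case (EdgeC n)
    then show ?thesis using xs f
      by (simp add: args_def graph_sig_def iso_class_in_agraphs tgraph_edge_graph)
  qed
  then show ?thesis unfolding algebra_def using sig agraphs_disjoint by (simp add: graph_alg_def)
qed

lemma sat_iso:
  assumes dom: "verts G \<inter> edges G = {}" "verts H \<inter> edges H = {}"
    and sub: "\<And>e. e \<in> edges G \<Longrightarrow> set (ends G e) \<subseteq> verts G"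
    and k: "bij_betw k (ind_dom G) (ind_dom H)" "k ` verts G = verts H" "k ` edges G = edges H"
    and e: "\<And>e. e \<in> edges G \<Longrightarrow> ends H (k e) = map k (ends G e)"
    and "range i \<subseteq> ind_dom G" "range s \<subseteq> set_dom G"
  shows "sat H (k \<circ> i) (\<lambda>X. k ` s X) \<phi> \<longleftrightarrow> sat G i s \<phi>"
  using assms(8,9)
proof (induction \<phi> arbitrary: i s)
  case (Vert x)
  then have "i x \<in> ind_dom G" by auto
  then show ?case using k by (auto simp: ind_dom_def bij_betw_def dest: inj_onD)
next
  case (Edge x)
  then have "i x \<in> ind_dom G" by auto
  then show ?case using k by (auto simp: ind_dom_def bij_betw_def dest: inj_onD)
next
  case (Eq x y)
  then have "i x \<in> ind_dom G" "i y \<in> ind_dom G" by auto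
  then show ?case using k(1) by (auto simp: bij_betw_def dest: inj_onD)
next
  case (Mem X x)
  then have "i x \<in> ind_dom G" "s X \<subseteq> ind_dom G" by (auto simp: set_dom_def ind_dom_def)
  then have "k (i x) \<in> k ` s X \<longleftrightarrow> i x \<in> s X"
    using k(1) inj_on_image_mem_iff by (metis bij_betw_imp_inj_on)
  then show ?case by simp
next
  case (Conn y xs)
  then have i: "i x \<in> ind_dom G" for x by auto
  have inj: "inj_on k (ind_dom G)" using k(1) by (simp add: bij_betw_def)
  have y: "k (i y) \<in> edges H \<longleftrightarrow> i y \<in> edges G"
    unfolding k(3)[symmetric] using inj i by (intro inj_on_image_mem_iff) (auto simp: ind_dom_def)
  have "map k (ends G (i y)) = map k (map i xs) \<longleftrightarrow> ends G (i y) = map i xs" if "i y \<in> edges G"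
    by (rule inj_on_map_eq_map, rule inj_on_subset[OF inj])
      (use sub[OF that] i in \<open>auto simp: ind_dom_def\<close>)
  then show ?case using y e by auto
next
  case (Neg \<phi>)
  then show ?case by simp
next
  case (And \<phi> \<psi>)
  then show ?case by simp
next
  case (AllI x \<phi>)
  have "sat H ((k \<circ> i)(x := k a)) (\<lambda>X. k ` s X) \<phi> \<longleftrightarrow> sat G (i(x := a)) s \<phi>"
    if "a \<in> ind_dom G" for a
  proof -
    have "range (i(x := a)) \<subseteq> ind_dom G" using that AllI.prems(1) by auto
    moreover have "(k \<circ> i)(x := k a) = k \<circ> i(x := a)" by auto
    ultimately show ?thesis using AllI.IH AllI.prems(2) by metis
  qed
  moreover have "ind_dom H = k ` ind_dom G" using k(1) by (simp add: bij_betw_def)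
  ultimately show ?case by (simp add: o_def)
next
  case (AllS X \<phi>)
  have "sat H (k \<circ> i) ((\<lambda>X. k ` s X)(X := k ` A)) \<phi> \<longleftrightarrow> sat G i (s(X := A)) \<phi>"
    if "A \<in> set_dom G" for A
  proof -
    have "range (s(X := A)) \<subseteq> set_dom G" using that AllS.prems(2) by auto
    moreover have "(\<lambda>X. k ` s X)(X := k ` A) = (\<lambda>Y. k ` (s(X := A)) Y)" by (rule ext) simp
    ultimately show ?thesis using AllS.IH AllS.prems(1) by metis
  qed
  moreover have "set_dom H = (\<lambda>A. k ` A) ` set_dom G"
    unfolding set_dom_def k(2,3)[symmetric] by (simp add: image_Un image_Pow_surj[OF refl])
  ultimately show ?case by (simp add: o_def)
qed

theorem models_iso:
  assumes "tgraph G" "tgraph H" "iso G H" shows "models G \<phi> \<longleftrightarrow> models H \<phi>"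
proof -
  have *: "models G \<phi>" if GH: "tgraph G" "tgraph H" "iso G H" and M: "models H \<phi>"
    for G :: "'c tgraph" and H :: "'d tgraph"
  proof -
    from GH(3) obtain f g where 1[rule_format]: "bij_betw f (verts G) (verts H)"
      "bij_betw g (edges G) (edges H)"
      "\<forall>e \<in> edges G. ends H (g e) = map f (ends G e)" unfolding iso_def by metis
    have d: "x \<notin> verts G" if "x \<in> edges G" for x using that tgraphD(4)[OF GH(1)] by auto
    define k where "k x = (if x \<in> verts G then f x else g x)" for x
    have "bij_betw k (verts G) (verts H) \<longleftrightarrow> bij_betw f (verts G) (verts H)"
      by (rule bij_betw_cong) (simp add: k_def)
    then have kv: "bij_betw k (verts G) (verts H)" using 1(1) by simp
    have "bij_betw k (edges G) (edges H) \<longleftrightarrow> bij_betw g (edges G) (edges H)"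
      by (rule bij_betw_cong) (simp add: k_def d)
    then have ke: "bij_betw k (edges G) (edges H)" using 1(2) by simp
    have kk: "bij_betw k (ind_dom G) (ind_dom H)" unfolding ind_dom_def
      by (rule bij_betw_combine[OF kv ke]) (rule tgraphD(4)[OF GH(2)])
    have km: "ends H (k e) = map k (ends G e)" if "e \<in> edges G" for e
      using 1(3)[OF that] d[OF that] tgraphD(6)[OF GH(1) that] by (simp add: k_def)
    have im: "k ` verts G = verts H" "k ` edges G = edges H"
      using kv ke by (simp_all add: bij_betw_imp_surj_on)
    have "sat G i s \<phi>" if iv: "range i \<subseteq> ind_dom G" "range s \<subseteq> set_dom G" for i s
    proof -
      have "range (k \<circ> i) \<subseteq> ind_dom H"
        using iv(1) bij_betw_imp_surj_on[OF kk] by auto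
      moreover have "k ` A \<in> set_dom H" if "A \<in> set_dom G" for A
        using that unfolding set_dom_def im[symmetric] by auto
      then have "range (\<lambda>X. k ` s X) \<subseteq> set_dom H" using iv(2) by blast
      ultimately have "sat H (k \<circ> i) (\<lambda>X. k ` s X) \<phi>" using M by (simp add: models_def)
      moreover have "sat H (k \<circ> i) (\<lambda>X. k ` s X) \<phi> \<longleftrightarrow> sat G i s \<phi>"
        by (rule sat_iso[OF tgraphD(4)[OF GH(1)] tgraphD(4)[OF GH(2)] _ kk im km iv])
          (use tgraphD(6)[OF GH(1)] in auto)
      ultimately show ?thesis by simp
    qed
    then show ?thesis by (simp add: models_def)
  qed
  show ?thesis using *[OF assms] *[OF assms(2,1) iso_sym[OF assms(1,3)]] by blast
qed

lemma amodels_iso_class: "tgraph G \<Longrightarrow> amodels (iso_class G) \<phi> \<longleftrightarrow> models G \<phi>"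
  unfolding amodels_def using ex_nat_copy[of G] models_iso[of G] by (auto simp: iso_class_def)

theorem recognisableI:
  fixes B :: "('s, 'f, 'b) algebra"
  assumes A: "algebra S A" and B: "algebra S B" "locally_finite S B" "morphism S A B h"
    and t: "t \<in> sorts S" and M: "M \<subseteq> carrier B t" and L: "L = {x \<in> carrier A t. h t x \<in> M}"
  shows "recognisable S A t L"
proof -
  have "\<exists>c :: 'b \<Rightarrow> nat. inj_on c (carrier B u)" if "u \<in> sorts S" for u
    using that B(2) finite_imp_inj_to_nat_seg unfolding locally_finite_def by metis
  then obtain c :: "'s \<Rightarrow> 'b \<Rightarrow> nat" where c: "\<And>u. u \<in> sorts S \<Longrightarrow> inj_on (c u) (carrier B u)"
    by metis
  define k where "k u x = (u, c u x)" for u x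
  define l where "l u = inv_into (carrier B u) (k u)" for u
  define B' :: "('s, 'f, 's \<times> nat) algebra" where
    "B' = \<lparr>carrier = (\<lambda>u. k u ` carrier B u),
           opn = (\<lambda>f ys. k (cod_sort S f) (opn B f (map2 l (dom_sorts S f) ys)))\<rparr>"
  have k: "inj_on (k u) (carrier B u)" if "u \<in> sorts S" for u
    using c[OF that] by (auto simp: k_def inj_on_def)
  have lk: "l u (k u x) = x" if "u \<in> sorts S" "x \<in> carrier B u" for u x
    using k that by (simp add: l_def)
  have S: "set (dom_sorts S f) \<subseteq> sorts S" "cod_sort S f \<in> sorts S" if "f \<in> funs S" for f
    using A that by (auto simp: algebra_def signature_def)
  have argsl: "map2 l (dom_sorts S f) ys \<in> args S B f"
    if "f \<in> funs S" "ys \<in> args S B' f" for f ys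
  proof -
    have ys: "length ys = length (dom_sorts S f)"
      "\<And>i. i < length ys \<Longrightarrow> ys ! i \<in> k (dom_sorts S f ! i) ` carrier B (dom_sorts S f ! i)"
      using that(2) by (simp_all add: args_def list_all2_conv_all_nth B'_def)
    have "l (dom_sorts S f ! i) (ys ! i) \<in> carrier B (dom_sorts S f ! i)" if i: "i < length ys" for i
      unfolding l_def using ys(2)[OF i] by (rule inv_into_into)
    then show ?thesis using ys(1) by (simp add: args_def list_all2_conv_all_nth)
  qed
  have argsh: "map2 h (dom_sorts S f) xs \<in> args S B f" 
      "map2 l (dom_sorts S f) (map2 (\<lambda>u x. k u (h u x)) (dom_sorts S f) xs) = map2 h (dom_sorts S f) xs"
    if "f \<in> funs S" "xs \<in> args S A f" for f xs
  proof -
    have a: "length xs = length (dom_sorts S f)"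
      "\<And>i. i < length xs \<Longrightarrow> xs ! i \<in> carrier A (dom_sorts S f ! i)"
      using that by (auto simp: args_def list_all2_conv_all_nth)
    have s: "\<And>i. i < length xs \<Longrightarrow> dom_sorts S f ! i \<in> sorts S"
      using S(1)[OF that(1)] a(1) by auto
    have hh: "\<And>i. i < length xs \<Longrightarrow> h (dom_sorts S f ! i) (xs ! i) \<in> carrier B (dom_sorts S f ! i)"
      using B(3) a(2) s unfolding morphism_def by blast
    show "map2 h (dom_sorts S f) xs \<in> args S B f"
      using a(1) hh by (simp add: args_def list_all2_conv_all_nth)
    show "map2 l (dom_sorts S f) (map2 (\<lambda>u x. k u (h u x)) (dom_sorts S f) xs)
        = map2 h (dom_sorts S f) xs"
      by (rule nth_equalityI) (use a(1) hh s lk in auto)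
  qed
  have "algebra S B'"
  proof -
    have "carrier B' u \<inter> carrier B' v = {}" if "u \<noteq> v" for u v
      using that by (auto simp: B'_def k_def)
    moreover have "opn B' f ys \<in> carrier B' (cod_sort S f)"
      if "f \<in> funs S" "ys \<in> args S B' f" for f ys
      using argsl[OF that] B(1) that(1) by (auto simp: B'_def algebra_def)
    ultimately show ?thesis using A by (auto simp: algebra_def)
  qed
  moreover have "locally_finite S B'" using B(2) by (simp add: locally_finite_def B'_def)
  moreover have "morphism S A B' (\<lambda>u x. k u (h u x))"
    using B(3) argsh(2) unfolding morphism_def by (auto simp: B'_def Pi_def)
  moreover have "k t ` M \<subseteq> carrier B' t" using M by (auto simp: B'_def)
  moreover have "L = {x \<in> carrier A t. k t (h t x) \<in> k t ` M}"
  proof -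
    have "k t (h t x) \<in> k t ` M \<longleftrightarrow> h t x \<in> M" if "x \<in> carrier A t" for x
    proof (rule inj_on_image_mem_iff[OF k[OF t] _ M])
      show "h t x \<in> carrier B t" using B(3) that t by (auto simp: morphism_def)
    qed
    then show ?thesis using L by auto
  qed
  ultimately show ?thesis unfolding recognisable_def by blast
qed

end

theory Submission
  imports Defs
begin

text \<open>Two graphs of the same type are compared by a back-and-forth game of bounded length in which
  the players choose sets and the atomic information consists of inclusions, incidence and membership
  of terminals. On each sort this gives an equivalence of finite index. It is compatible with the
  operations: a move in a disjoint sum is a pair of moves, and a move in a fused graph is a move in
  the original graph with a set that contains either both or none of the fused terminals, which is
  atomic information. Enough moves decide the sentence, so the quotient by the equivalence is a
  locally finite algebra that recognises its models.\<close>

text \<open>Individual variables are played as sets because single elements do not behave well under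
  the operations: an element of a disjoint sum lies in one summand, so that the other summand must
  receive the empty set as its share, and a fused vertex comes from a pair. With sets as the only
  moves, every operation preserves the equivalence without loss of moves or variables, which makes
  it a congruence on all sorts at once. The price is paid when a formula is evaluated: a singleton
  has to be recognised by a play, hence one move more than the quantifier depth. Terminals are
  invisible to formulas but belong to the atomic information, since fusion acts through them.
  Besides the finitely many variables, two bounds make the index finite: a fixed sort has finitely
  many terminals, and incidence is tested only for words no longer than those in the sentence,
  although edges may be arbitrarily long.\<close>

text \<open>\<open>Inl x\<close> stands for an individual variable, whose value is coded as a singleton, and \<open>Inr X\<close>
  for a set variable.\<close>

type_synonym var = "nat + nat"

section \<open>Atomic information and the back-and-forth equivalence\<close>

datatype literal =
    InV var
  | InE var
  | Sub var var
  | Inc var "var list"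
  | Trm nat var

text \<open>\<open>Inc\<close> asks only for some edge in \<open>S Y\<close> whose ends lie in the
  given sets in order. An existential statement of this kind passes to preimages under quotients and
  splits over disjoint sums; on singletons it becomes \<open>Conn\<close>.\<close>

fun holds :: "'a tgraph \<Rightarrow> (var \<Rightarrow> 'a set) \<Rightarrow> literal \<Rightarrow> bool" where
  "holds G S (InV X) \<longleftrightarrow> S X \<subseteq> verts G"
| "holds G S (InE X) \<longleftrightarrow> S X \<subseteq> edges G"
| "holds G S (Sub X Y) \<longleftrightarrow> S X \<subseteq> S Y"
| "holds G S (Inc Y Xs) \<longleftrightarrow> (\<exists>e \<in> S Y \<inter> edges G. list_all2 (\<lambda>v X. v \<in> S X) (ends G e) Xs)"
| "holds G S (Trm i X) \<longleftrightarrow> trm G i \<in> S X"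

definition literals :: "var set \<Rightarrow> nat \<Rightarrow> nat \<Rightarrow> literal set" where
  "literals W M n = InV ` W \<union> InE ` W \<union> case_prod Sub ` (W \<times> W) \<union>
     case_prod Inc ` (W \<times> {Xs. set Xs \<subseteq> W \<and> length Xs \<le> M}) \<union>
     case_prod Trm ` ({1..n} \<times> W)"

lemma literals_simps [simp]:
  "InV X \<in> literals W M n \<longleftrightarrow> X \<in> W" "InE X \<in> literals W M n \<longleftrightarrow> X \<in> W"
  "Sub X Y \<in> literals W M n \<longleftrightarrow> X \<in> W \<and> Y \<in> W"
  "Inc Y Xs \<in> literals W M n \<longleftrightarrow> Y \<in> W \<and> set Xs \<subseteq> W \<and> length Xs \<le> M"
  "Trm i X \<in> literals W M n \<longleftrightarrow> i \<in> {1..n} \<and> X \<in> W"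
  by (auto simp: literals_def image_iff split_beta)

lemma finite_literals: "finite W \<Longrightarrow> finite (literals W M n)"
  by (simp add: literals_def finite_lists_length_le)

definition agree ::
    "var set \<Rightarrow> nat \<Rightarrow> 'a tgraph \<Rightarrow> (var \<Rightarrow> 'a set) \<Rightarrow> 'b tgraph \<Rightarrow> (var \<Rightarrow> 'b set) \<Rightarrow> bool" where
  "agree W M G S H T \<longleftrightarrow>
     rank G = rank H \<and> (\<forall>l \<in> literals W M (rank G). holds G S l \<longleftrightarrow> holds H T l)"

text \<open>The moves are arbitrary subsets of the domain, mixed ones included: this makes the moves in a
  disjoint sum independent in the two summands, and mixed sets are told apart by \<open>InV\<close> and \<open>InE\<close>.\<close>

primrec eqv ::
    "var set \<Rightarrow> nat \<Rightarrow> nat \<Rightarrow> 'a tgraph \<Rightarrow> (var \<Rightarrow> 'a set) \<Rightarrow> 'b tgraph \<Rightarrow> (var \<Rightarrow> 'b set) \<Rightarrow> bool" where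
  "eqv W M 0 G S H T \<longleftrightarrow> agree W M G S H T"
| "eqv W M (Suc k) G S H T \<longleftrightarrow> agree W M G S H T \<and>
     (\<forall>X \<in> W. rel_set (\<lambda>A B. eqv W M k G (S(X := A)) H (T(X := B))) (Pow (ind_dom G)) (Pow (ind_dom H)))"

lemma eqv_agree: "eqv W M k G S H T \<Longrightarrow> agree W M G S H T"
  by (cases k) auto

lemma eqv_refl: "eqv W M k G S G S"
proof (induction k arbitrary: S)
  case (Suc k)
  then show ?case by (auto simp: agree_def rel_set_def)
qed (simp add: agree_def)

lemma eqv_sym: "eqv W M k G S H T \<Longrightarrow> eqv W M k H T G S"
proof (induction k arbitrary: S T)
  case (Suc k)
  then have "agree W M H T G S" by (simp add: agree_def)
  with Suc show ?case unfolding eqv.simps rel_set_def by meson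
qed (simp add: agree_def)

lemma rel_set_trans:
  assumes "rel_set R A B" "rel_set R' B C" "\<And>a b c. R a b \<Longrightarrow> R' b c \<Longrightarrow> Q a c"
  shows "rel_set Q A C"
  using assms unfolding rel_set_def by meson

lemma eqv_trans: "eqv W M k G S H T \<Longrightarrow> eqv W M k H T K U \<Longrightarrow> eqv W M k G S K U"
proof (induction k arbitrary: S T U)
  case (Suc k)
  then have "agree W M G S K U" by (simp add: agree_def)
  moreover have "rel_set (\<lambda>A B. eqv W M k G (S(X := A)) K (U(X := B)))
      (Pow (ind_dom G)) (Pow (ind_dom K))" if "X \<in> W" for X
  proof (rule rel_set_trans)
    show "rel_set (\<lambda>A B. eqv W M k G (S(X := A)) H (T(X := B))) (Pow (ind_dom G)) (Pow (ind_dom H))"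
      and "rel_set (\<lambda>A B. eqv W M k H (T(X := A)) K (U(X := B))) (Pow (ind_dom H)) (Pow (ind_dom K))"
      using Suc.prems that by simp_all
  qed (rule Suc.IH)
  ultimately show ?case by simp
qed (simp add: agree_def)

section \<open>Finite index\<close>

text \<open>A position is described by its true literals together with the descriptions reachable by
  one move. These iterated sets would have a type that changes with \<open>k\<close>, so at each
  stage the finitely many descriptions are renumbered by natural numbers.\<close>

lemma eqv_finite_index:
  assumes "finite W"
  shows "\<exists>c :: 'a tgraph \<Rightarrow> (var \<Rightarrow> 'a set) \<Rightarrow> nat.
    finite {c G S |G S. rank G = n} \<and>
    (\<forall>G S H T. rank G = n \<and> rank H = n \<and> c G S = c H T \<longrightarrow> eqv W M k G S H T)"
    (is "\<exists>c. ?P k c")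
proof -
  have code: "\<exists>c. ?P k c"
    if fin: "finite R" and c: "\<And>G S. rank G = n \<Longrightarrow> c G S \<in> R"
      and eq: "\<And>G S H T. rank G = n \<Longrightarrow> rank H = n \<Longrightarrow> c G S = c H T \<Longrightarrow> eqv W M k G S H T"
    for k and R :: "'r set" and c :: "'a tgraph \<Rightarrow> (var \<Rightarrow> 'a set) \<Rightarrow> 'r"
  proof -
    obtain f :: "'r \<Rightarrow> nat" where f: "inj_on f R" using finite_imp_inj_to_nat_seg[OF fin] by metis
    have "{f (c G S) |G S. rank G = n} \<subseteq> f ` R" using c by blast
    then have "finite {f (c G S) |G S. rank G = n}" using finite_subset fin by blast
    moreover have "eqv W M k G S H T" if "rank G = n" "rank H = n" "f (c G S) = f (c H T)" for G S H T
      using that eq inj_onD[OF f that(3) c c] by blast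
    ultimately show ?thesis by (intro exI[of _ "\<lambda>G S. f (c G S)"]) blast
  qed
  let ?L = "\<lambda>G S. {l \<in> literals W M n. holds G S l}"
  note fin = finite_literals[OF assms, of M n]
  have agree: "agree W M G S H T" if "rank G = n" "rank H = n" "?L G S = ?L H T"
    for G H :: "'a tgraph" and S T
    using that by (auto simp: agree_def set_eq_iff)
  show ?thesis
  proof (induction k)
    case 0
    show ?case by (rule code[of "Pow (literals W M n)" ?L]) (use fin agree in auto)
  next
    case (Suc k)
    then obtain c :: "'a tgraph \<Rightarrow> (var \<Rightarrow> 'a set) \<Rightarrow> nat" where c: "?P k c" by blast
    let ?c = "\<lambda>G S. (?L G S, (\<lambda>(X, A). (X, c G (S(X := A)))) ` (W \<times> Pow (ind_dom G)))"
    let ?R = "Pow (literals W M n) \<times> Pow (W \<times> {c G S |G S. rank G = n})"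
    \<comment> \<open>Equal descriptions contain the same pairs of a variable and a code, so a move
      on one side has an answer on the other; exchanging the sides gives the converse.\<close>
    have forth: "\<exists>B \<in> Pow (ind_dom H). c G (S(X := A)) = c H (T(X := B))"
      if "?c G S = ?c H T" "X \<in> W" "A \<in> Pow (ind_dom G)" for G H S T X A
    proof -
      have "(X, c G (S(X := A))) \<in> snd (?c G S)" using that(2,3) by force
      then have "(X, c G (S(X := A))) \<in> snd (?c H T)" unfolding that(1) .
      then show ?thesis by auto
    qed
    show ?case
    proof (rule code[of ?R ?c])
      show "finite ?R" using fin assms c by simp
      show "?c G S \<in> ?R" if "rank G = n" for G S using that by auto
      show "eqv W M (Suc k) G S H T"
        if r: "rank G = n" "rank H = n" and eq: "?c G S = ?c H T" for G H S T
        unfolding eqv.simps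
      proof (intro conjI ballI rel_setI)
        show "agree W M G S H T" using agree[OF r] eq by simp
      next
        fix X A assume "X \<in> W" "A \<in> Pow (ind_dom G)"
        then obtain B where "B \<in> Pow (ind_dom H)" "c G (S(X := A)) = c H (T(X := B))"
          using forth[OF eq] by blast
        then show "\<exists>B \<in> Pow (ind_dom H). eqv W M k G (S(X := A)) H (T(X := B))"
          using c r by blast
      next
        fix X B assume "X \<in> W" "B \<in> Pow (ind_dom H)"
        then obtain A where "A \<in> Pow (ind_dom G)" "c H (T(X := B)) = c G (S(X := A))"
          using forth[OF eq[symmetric]] by blast
        then show "\<exists>A \<in> Pow (ind_dom G). eqv W M k G (S(X := A)) H (T(X := B))"
          using c r by metis
      qed
    qed
  qed
qed

section \<open>Disjoint sums and redefinition of terminals\<close>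

text \<open>Meant for quotients, where \<open>P\<close> and \<open>Q\<close> select the moves that
  descend: if related moves are selected together, the back-and-forth property survives the
  restriction.\<close>

lemma rel_set_filter_image:
  assumes "rel_set R A B" "\<And>a b. a \<in> A \<Longrightarrow> b \<in> B \<Longrightarrow> R a b \<Longrightarrow> P a \<longleftrightarrow> Q b"
    and "\<And>a b. a \<in> A \<Longrightarrow> b \<in> B \<Longrightarrow> R a b \<Longrightarrow> P a \<Longrightarrow> Q b \<Longrightarrow> R' (f a) (g b)"
  shows "rel_set R' (f ` {a \<in> A. P a}) (g ` {b \<in> B. Q b})"
  using assms unfolding rel_set_def by (simp add: ball_simps) metis

lemma rel_set_image2:
  assumes "rel_set R A B" "rel_set R' A' B'"
    and "\<And>a b a' b'. R a b \<Longrightarrow> R' a' b' \<Longrightarrow> Q (f a a') (g b b')"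
  shows "rel_set Q (case_prod f ` (A \<times> A')) (case_prod g ` (B \<times> B'))"
proof -
  have "rel_set (rel_prod R R') (A \<times> A') (B \<times> B')"
    using assms(1,2) unfolding rel_set_def by fastforce
  then show ?thesis using assms(3) unfolding rel_set_def by fastforce
qed

text \<open>\<open>Inc\<close> gives a disjunction because an edge lies in one summand together with
  all its ends; inclusions must hold in both summands, and the number of a terminal selects its
  summand.\<close>

lemma holds_disj_sum:
  "holds (disj_sum G H) (\<lambda>X. S X <+> T X) l \<longleftrightarrow>
    (case l of Inc Y Xs \<Rightarrow> holds G S l \<or> holds H T l
     | Trm i X \<Rightarrow> if i \<le> rank G then holds G S l else holds H T (Trm (i - rank G) X)
     | _ \<Rightarrow> holds G S l \<and> holds H T l)"
proof (cases l)
  case (Inc Y Xs)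
  have "list_all2 (\<lambda>v X. v \<in> S X <+> T X) (map Inl vs) Xs \<longleftrightarrow> list_all2 (\<lambda>v X. v \<in> S X) vs Xs"
    "list_all2 (\<lambda>v X. v \<in> S X <+> T X) (map Inr ws) Xs \<longleftrightarrow> list_all2 (\<lambda>v X. v \<in> T X) ws Xs"
    for vs ws by (simp_all add: list_all2_map1 Plus_def image_iff)
  moreover have "holds (disj_sum G H) (\<lambda>X. S X <+> T X) l \<longleftrightarrow>
      (\<exists>e \<in> S Y \<inter> edges G. list_all2 (\<lambda>v X. v \<in> S X <+> T X) (map Inl (ends G e)) Xs) \<or>
      (\<exists>e \<in> T Y \<inter> edges H. list_all2 (\<lambda>v X. v \<in> S X <+> T X) (map Inr (ends H e)) Xs)"
    by (force simp: Inc disj_sum_def)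
  ultimately show ?thesis using Inc by simp
qed (auto simp: disj_sum_def)

lemma ind_dom_disj_sum: "ind_dom (disj_sum G H) = ind_dom G <+> ind_dom H"
  by (auto simp: ind_dom_def disj_sum_def)

lemma Pow_Plus: "Pow (A <+> B) = case_prod (<+>) ` (Pow A \<times> Pow B)"
proof (intro equalityI subsetI)
  fix C assume "C \<in> Pow (A <+> B)"
  then have "C = (Inl -` C) <+> (Inr -` C)" "Inl -` C \<subseteq> A" "Inr -` C \<subseteq> B" by auto
  then show "C \<in> case_prod (<+>) ` (Pow A \<times> Pow B)" by blast
qed auto

lemma eqv_disj_sum:
  assumes "eqv W M k G S G' S'" "eqv W M k H T H' T'"
  shows "eqv W M k (disj_sum G H) (\<lambda>X. S X <+> T X) (disj_sum G' H') (\<lambda>X. S' X <+> T' X)"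
  using assms
proof (induction k arbitrary: S S' T T')
  have agr: "agree W M (disj_sum G H) (\<lambda>X. S X <+> T X) (disj_sum G' H') (\<lambda>X. S' X <+> T' X)"
    if "agree W M G S G' S'" "agree W M H T H' T'" for S S' T T'
  proof -
    \<comment> \<open>Equal ranks put the border between the two blocks of terminals at the same
      index on both sides.\<close>
    have r: "rank G' = rank G" "rank H' = rank H" using that by (auto simp: agree_def)
    have "holds (disj_sum G H) (\<lambda>X. S X <+> T X) l \<longleftrightarrow>
        holds (disj_sum G' H') (\<lambda>X. S' X <+> T' X) l"
      if l: "l \<in> literals W M (rank G + rank H)" for l
    proof (cases l)
      case (Trm i X)
      then have i: "X \<in> W" "1 \<le> i" "i \<le> rank G + rank H" using l by auto
      show ?thesis
      proof (cases "i \<le> rank G")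
        case True
        then have "Trm i X \<in> literals W M (rank G)" using i by simp
        then have "holds G S l \<longleftrightarrow> holds G' S' l"
          using Trm \<open>agree W M G S G' S'\<close> unfolding agree_def by blast
        then show ?thesis unfolding holds_disj_sum using True r by (simp add: Trm)
      next
        case False
        then have "Trm (i - rank G) X \<in> literals W M (rank H)" using i by auto
        then have "holds H T (Trm (i - rank G) X) \<longleftrightarrow> holds H' T' (Trm (i - rank G) X)"
          using \<open>agree W M H T H' T'\<close> unfolding agree_def by blast
        then show ?thesis unfolding holds_disj_sum using False r by (simp add: Trm)
      qed
    qed (use l \<open>agree W M G S G' S'\<close> \<open>agree W M H T H' T'\<close> in
        \<open>auto simp: holds_disj_sum agree_def simp del: holds.simps\<close>)
    then show ?thesis using r by (simp add: agree_def)
  qed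
  {
    case 0
    then show ?case using agr by simp
  next
    case (Suc k)
    \<comment> \<open>A move in the sum updates both summands at the same variable, so the position
      keeps the form that the induction hypothesis requires.\<close>
    have upd: "(\<lambda>Y. S Y <+> T Y)(X := A <+> B) = (\<lambda>Y. (S(X := A)) Y <+> (T(X := B)) Y)"
      for S :: "var \<Rightarrow> 'x set" and T :: "var \<Rightarrow> 'y set" and X A B by (simp add: fun_eq_iff)
    show ?case unfolding eqv.simps ind_dom_disj_sum Pow_Plus
    proof (intro conjI ballI agr)
      fix X assume X: "X \<in> W"
      show "rel_set (\<lambda>A B. eqv W M k (disj_sum G H) ((\<lambda>X. S X <+> T X)(X := A))
          (disj_sum G' H') ((\<lambda>X. S' X <+> T' X)(X := B)))
        (case_prod (<+>) ` (Pow (ind_dom G) \<times> Pow (ind_dom H)))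
        (case_prod (<+>) ` (Pow (ind_dom G') \<times> Pow (ind_dom H')))"
      proof (rule rel_set_image2)
        show "rel_set (\<lambda>A B. eqv W M k G (S(X := A)) G' (S'(X := B)))
            (Pow (ind_dom G)) (Pow (ind_dom G'))"
          and "rel_set (\<lambda>A B. eqv W M k H (T(X := A)) H' (T'(X := B)))
            (Pow (ind_dom H)) (Pow (ind_dom H'))" using Suc.prems X by simp_all
      qed (unfold upd, rule Suc.IH)
    qed (use Suc.prems in simp_all)
  }
qed

text \<open>The moves stay the same. Only terminal literals change: \<open>Trm i X\<close> after the
  redefinition is \<open>Trm (\<sigma> i) X\<close> before it.\<close>

lemma eqv_redefine:
  assumes "eqv W M k G S H T" "\<sigma> \<in> {1..n} \<rightarrow> {1..rank G}"
  shows "eqv W M k (redefine n \<sigma> G) S (redefine n \<sigma> H) T"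
  using assms(1)
proof (induction k arbitrary: S T)
  have agr: "agree W M (redefine n \<sigma> G) S (redefine n \<sigma> H) T" if "agree W M G S H T" for S T
  proof -
    have "holds (redefine n \<sigma> G) S l \<longleftrightarrow> holds (redefine n \<sigma> H) T l" if l: "l \<in> literals W M n" for l
    proof -
      let ?l = "case l of Trm i X \<Rightarrow> Trm (\<sigma> i) X | _ \<Rightarrow> l"
      have *: "holds (redefine n \<sigma> K) U l \<longleftrightarrow> holds K U ?l" for K :: "'x tgraph" and U
        by (cases l) (auto simp: redefine_def)
      have "?l \<in> literals W M (rank G)" using l assms(2) by (cases l) (auto simp: Pi_iff)
      then show ?thesis unfolding * using \<open>agree W M G S H T\<close> unfolding agree_def by blast
    qed
    then show ?thesis by (simp add: agree_def)
  qed
  have dom: "ind_dom (redefine n \<sigma> K) = ind_dom K" for K :: "'x tgraph"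
    by (simp add: ind_dom_def redefine_def)
  {
    case 0
    then show ?case using agr by simp
  next
    case (Suc k)
    then show ?case unfolding eqv.simps dom rel_set_def using agr by blast
  }
qed

section \<open>Quotient maps, fusion and isomorphism\<close>

text \<open>One map serves vertices and edges alike, because the sets pulled back along it may mix
  the two kinds.\<close>

definition quotient_map :: "('a \<Rightarrow> 'b) \<Rightarrow> 'a tgraph \<Rightarrow> 'b tgraph \<Rightarrow> bool" where
  "quotient_map f G H \<longleftrightarrow> tgraph G \<and> tgraph H \<and> rank G = rank H \<and>
     f ` verts G = verts H \<and> f ` edges G = edges H \<and>
     (\<forall>e \<in> edges G. ends H (f e) = map f (ends G e)) \<and>
     (\<forall>i \<in> {1..rank G}. trm H i = f (trm G i))"

definition pull :: "('a \<Rightarrow> 'b) \<Rightarrow> 'a tgraph \<Rightarrow> 'b set \<Rightarrow> 'a set" where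
  "pull f G A = {x \<in> ind_dom G. f x \<in> A}"

text \<open>The unions of fibres of \<open>f\<close> within the domain.\<close>

definition saturated :: "('a \<Rightarrow> 'b) \<Rightarrow> 'a tgraph \<Rightarrow> 'a set \<Rightarrow> bool" where
  "saturated f G A \<longleftrightarrow> pull f G (f ` A) = A"

lemma quotient_mapD:
  assumes "quotient_map f G H"
  shows "tgraph G" "tgraph H" "rank G = rank H" "f ` verts G = verts H" "f ` edges G = edges H"
    "f ` ind_dom G = ind_dom H"
    "e \<in> edges G \<Longrightarrow> ends H (f e) = map f (ends G e)"
    "1 \<le> i \<Longrightarrow> i \<le> rank G \<Longrightarrow> trm H i = f (trm G i)"
  using assms unfolding quotient_map_def ind_dom_def by (auto simp: image_Un)

text \<open>Preimages under a surjection reflect inclusion, and every edge of \<open>H\<close> lifts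
  to an edge of \<open>G\<close> whose ends lie over its ends.\<close>

lemma holds_pull:
  assumes q: "quotient_map f G H" and S: "\<And>X. S X \<subseteq> ind_dom H"
    and l: "l \<in> literals W M (rank G)"
  shows "holds G (\<lambda>X. pull f G (S X)) l \<longleftrightarrow> holds H S l"
proof -
  note qD = quotient_mapD[OF q] and GD = tgraphD[OF quotient_mapD(1)[OF q]]
    and HD = tgraphD[OF quotient_mapD(2)[OF q]]
  have im: "f ` pull f G (S X) = S X" for X
    using S[of X] qD(6) unfolding pull_def by (auto simp: image_iff)
  have sub: "pull f G (S X) \<subseteq> pull f G C \<longleftrightarrow> S X \<subseteq> C" for X C
  proof
    assume "pull f G (S X) \<subseteq> pull f G C"
    then have "f ` pull f G (S X) \<subseteq> f ` pull f G C" by (rule image_mono)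
    then show "S X \<subseteq> C" unfolding im by (auto simp: pull_def)
  qed (auto simp: pull_def)
  \<comment> \<open>\<open>f\<close> respects both kinds and these are disjoint in \<open>H\<close>,
    so \<open>InV\<close> and \<open>InE\<close> also become inclusions between preimages.\<close>
  have VE: "verts G = pull f G (verts H)" "edges G = pull f G (edges H)"
    using qD(4,5) HD(4) GD(4) unfolding pull_def ind_dom_def by blast+
  show ?thesis
  proof (cases l)
    case (InV X)
    then show ?thesis using sub[of X "verts H"] VE by simp
  next
    case (InE X)
    then show ?thesis using sub[of X "edges H"] VE by simp
  next
    case (Sub X Y)
    then show ?thesis using sub[of X "S Y"] by simp
  next
    case (Inc Y Xs)
    have *: "list_all2 (\<lambda>v X. v \<in> pull f G (S X)) (ends G e) Xs \<longleftrightarrow>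
        list_all2 (\<lambda>v X. v \<in> S X) (ends H (f e)) Xs" if e: "e \<in> edges G" for e
    proof -
      have "v \<in> ind_dom G" if "v \<in> set (ends G e)" for v
        using GD(6)[OF e that] by (simp add: ind_dom_def)
      then show ?thesis unfolding qD(7)[OF e] list_all2_map1
        by (intro list.rel_cong_simp) (auto simp: pull_def simp_implies_def)
    qed
    have "holds H S (Inc Y Xs) \<longleftrightarrow>
        (\<exists>e \<in> edges G. f e \<in> S Y \<and> list_all2 (\<lambda>v X. v \<in> S X) (ends H (f e)) Xs)"
      unfolding holds.simps qD(5)[symmetric] by auto
    also have "\<dots> \<longleftrightarrow> holds G (\<lambda>X. pull f G (S X)) (Inc Y Xs)"
      using * by (auto simp: pull_def[of _ _ "S Y"] ind_dom_def)
    finally show ?thesis using Inc by simp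
  next
    case (Trm i X)
    then have i: "1 \<le> i" "i \<le> rank G" using l by auto
    then have "trm G i \<in> ind_dom G" using GD(7) by (simp add: ind_dom_def)
    then show ?thesis using Trm qD(8)[OF i] by (simp add: pull_def)
  qed
qed

lemma Pow_ind_dom_quotient:
  assumes "quotient_map f G H"
  shows "Pow (ind_dom H) = (`) f ` {A \<in> Pow (ind_dom G). saturated f G A}"
proof -
  have im: "f ` pull f G B = B" if "B \<subseteq> ind_dom H" for B
    using that quotient_mapD(6)[OF assms] unfolding pull_def by (auto simp: image_iff)
  show ?thesis
  proof (intro equalityI subsetI)
    fix B assume "B \<in> Pow (ind_dom H)"
    then show "B \<in> (`) f ` {A \<in> Pow (ind_dom G). saturated f G A}"
      using im by (intro image_eqI[of _ _ "pull f G B"]) (auto simp: saturated_def pull_def)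
  qed (use quotient_mapD(6)[OF assms] in auto)
qed

text \<open>Applied both to fusions and, with the identity as one of the two maps, to isomorphisms.\<close>

lemma eqv_quotient:
  assumes f: "quotient_map f G G'" and g: "quotient_map g H H'"
    and sat: "\<And>A B. A \<subseteq> ind_dom G \<Longrightarrow> B \<subseteq> ind_dom H \<Longrightarrow>
      (\<And>i. i \<in> {1..rank G} \<Longrightarrow> trm G i \<in> A \<longleftrightarrow> trm H i \<in> B) \<Longrightarrow> saturated f G A \<longleftrightarrow> saturated g H B"
    and "eqv W M k G (\<lambda>X. pull f G (S X)) H (\<lambda>X. pull g H (T X))"
    and "\<And>X. S X \<subseteq> ind_dom G'" "\<And>X. T X \<subseteq> ind_dom H'"
  shows "eqv W M k G' S H' T"
  using assms(4-)
proof (induction k arbitrary: S T)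
  have agr: "agree W M G' S H' T"
    if ag: "agree W M G (\<lambda>X. pull f G (S X)) H (\<lambda>X. pull g H (T X))"
      and ST: "\<And>X. S X \<subseteq> ind_dom G'" "\<And>X. T X \<subseteq> ind_dom H'" for S T
  proof -
    have r: "rank G = rank H" using ag by (simp add: agree_def)
    have "holds G' S l \<longleftrightarrow> holds H' T l" if "l \<in> literals W M (rank G)" for l
      using ag that holds_pull[of f G G' S l W M, OF f ST(1) that] holds_pull[of g H H' T l W M, OF g ST(2) that[unfolded r]]
      unfolding agree_def by blast
    then show ?thesis using r quotient_mapD(3)[OF f] quotient_mapD(3)[OF g] by (simp add: agree_def)
  qed
  {
    case 0
    then show ?case using agr by simp
  next
    case (Suc k)
    have "rel_set (\<lambda>A B. eqv W M k G' (S(X := A)) H' (T(X := B))) (Pow (ind_dom G')) (Pow (ind_dom H'))"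
      if X: "X \<in> W" for X
      unfolding Pow_ind_dom_quotient[OF f] Pow_ind_dom_quotient[OF g]
    proof (rule rel_set_filter_image)
      show "rel_set (\<lambda>A B. eqv W M k G ((\<lambda>X. pull f G (S X))(X := A)) H ((\<lambda>X. pull g H (T X))(X := B)))
          (Pow (ind_dom G)) (Pow (ind_dom H))" using Suc.prems(1) X by simp
    next
      fix A B assume AB: "A \<in> Pow (ind_dom G)" "B \<in> Pow (ind_dom H)"
        and e: "eqv W M k G ((\<lambda>X. pull f G (S X))(X := A)) H ((\<lambda>X. pull g H (T X))(X := B))"
      \<comment> \<open>The position after the two moves still agrees on terminal literals, so a
        saturated move is answered by a saturated one, which descends to the quotient.\<close>
      show "saturated f G A \<longleftrightarrow> saturated g H B"
      proof (rule sat)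
        fix i assume i: "i \<in> {1..rank G}"
        then have "Trm i X \<in> literals W M (rank G)" using X by auto
        then show "trm G i \<in> A \<longleftrightarrow> trm H i \<in> B"
          using eqv_agree[OF e] unfolding agree_def by fastforce
      qed (use AB in auto)
      assume "saturated f G A" "saturated g H B"
      \<comment> \<open>A saturated set is the preimage of its image, so the new position again
        consists of preimages.\<close>
      then have "(\<lambda>X. pull f G (S X))(X := A) = (\<lambda>Y. pull f G ((S(X := f ` A)) Y))"
          "(\<lambda>X. pull g H (T X))(X := B) = (\<lambda>Y. pull g H ((T(X := g ` B)) Y))"
        by (auto simp: saturated_def fun_eq_iff)
      moreover have "f ` A \<subseteq> ind_dom G'" "g ` B \<subseteq> ind_dom H'"
        unfolding quotient_mapD(6)[OF f, symmetric] quotient_mapD(6)[OF g, symmetric]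
        using AB by (auto intro!: imageI)
      ultimately show "eqv W M k G' (S(X := f ` A)) H' (T(X := g ` B))"
        using e Suc.prems(2,3) by (intro Suc.IH) auto
    qed
    then show ?case using agr Suc.prems by simp
  }
qed


lemma saturatedI:
  assumes "\<And>x y. x \<in> A \<Longrightarrow> y \<in> ind_dom G \<Longrightarrow> f x = f y \<Longrightarrow> y \<in> A" "A \<subseteq> ind_dom G"
  shows "saturated f G A"
  using assms unfolding saturated_def pull_def by (auto simp: image_iff)

lemma eqv_iso:
  assumes "tgraph G" "tgraph H" "iso G H"
  shows "eqv W M k G (\<lambda>_. {}) H (\<lambda>_. {})"
proof -
  from assms(3) obtain f g where 1[rule_format]: "rank H = rank G" "bij_betw f (verts G) (verts H)"
    "bij_betw g (edges G) (edges H)"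
    "\<forall>e \<in> edges G. ends H (g e) = map f (ends G e)"
    "\<forall>i \<in> {1..rank G}. trm H i = f (trm G i)" unfolding iso_def by metis
  note GD = tgraphD[OF assms(1)] and HD = tgraphD[OF assms(2)]
  \<comment> \<open>Vertices and edges are disjoint, so the two bijections glue to one map.\<close>
  define h where "h x = (if x \<in> verts G then f x else g x)" for x
  have hv: "h x = f x" if "x \<in> verts G" for x using that by (simp add: h_def)
  have he: "h x = g x" if "x \<in> edges G" for x using that GD(4) by (auto simp: h_def)
  have bh: "bij_betw h (verts G) (verts H)" "bij_betw h (edges G) (edges H)"
    using 1(2,3) bij_betw_cong[of "verts G" h f] bij_betw_cong[of "edges G" h g] hv he by blast+
  then have bij: "bij_betw h (ind_dom G) (ind_dom H)"
    using HD(4) unfolding ind_dom_def by (rule bij_betw_combine)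
  have im: "h ` verts G = verts H" "h ` edges G = edges H"
    using bh by (auto simp: bij_betw_def)
  have "map f (ends G e) = map h (ends G e)" if "e \<in> edges G" for e
    using GD(6)[OF that] hv by simp
  then have q: "quotient_map h G H"
    unfolding quotient_map_def using assms 1 im he hv GD(7) by simp
  have "quotient_map id G G" using assms(1) by (simp add: quotient_map_def)
  then show ?thesis
  proof (rule eqv_quotient[OF _ q])
    \<comment> \<open>Both maps are injective on the domain, so every subset is saturated.\<close>
    show "saturated id G A \<longleftrightarrow> saturated h G B" if "A \<subseteq> ind_dom G" "B \<subseteq> ind_dom G" for A B
    proof -
      have "saturated id G A" using that by (intro saturatedI) auto
      moreover have "saturated h G B" using that bij_betw_imp_inj_on[OF bij]
        by (intro saturatedI) (auto dest: inj_onD)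
      ultimately show ?thesis by simp
    qed
  qed (simp_all add: pull_def eqv_refl)
qed

lemma eqv_fuse:
  assumes "tgraph G" "tgraph H" "eqv W M k G (\<lambda>_. {}) H (\<lambda>_. {})"
    and ab: "a \<in> {1..rank G}" "b \<in> {1..rank G}"
  shows "eqv W M k (fuse a b G) (\<lambda>_. {}) (fuse a b H) (\<lambda>_. {})"
proof -
  let ?q = "\<lambda>K v. if v = trm K b then trm K a else v"
  have r: "rank H = rank G" using eqv_agree[OF assms(3)] by (simp add: agree_def)
  have q: "quotient_map (?q K) K (fuse a b K)" if "tgraph K" "rank K = rank G" for K :: "'x tgraph"
  proof -
    \<comment> \<open>The merging map moves at most one terminal, which is a vertex; hence it fixes
      all edges.\<close>
    have "trm K b \<notin> edges K" using tgraphD(4,7)[OF that(1)] ab that(2) by fastforce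
    then have "?q K e = e" if "e \<in> edges K" for e using that by auto
    then show ?thesis
      unfolding quotient_map_def using that ab by (auto simp: fuse_sel intro!: tgraph_fuse)
  qed
  \<comment> \<open>The fibre over the merged vertex is the only one that can have two
    elements.\<close>
  have sat: "saturated (?q K) K A \<longleftrightarrow> (trm K a \<in> A \<longleftrightarrow> trm K b \<in> A)"
    if "tgraph K" "rank K = rank G" "A \<subseteq> ind_dom K" for K :: "'x tgraph" and A
  proof -
    have "trm K a \<in> ind_dom K" "trm K b \<in> ind_dom K"
      using tgraphD(7)[OF that(1)] ab that(2) by (auto simp: ind_dom_def)
    then show ?thesis using that(3) unfolding saturated_def pull_def
      by (auto simp: image_iff split: if_splits)
  qed
  show ?thesis
  proof (rule eqv_quotient[OF q q])
    show "saturated (?q G) G A \<longleftrightarrow> saturated (?q H) H B"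
      if "A \<subseteq> ind_dom G" "B \<subseteq> ind_dom H"
        "\<And>i. i \<in> {1..rank G} \<Longrightarrow> trm G i \<in> A \<longleftrightarrow> trm H i \<in> B" for A B
      using sat[OF assms(1) refl that(1)] sat[OF assms(2) r that(2)] that(3)[OF ab(1)] that(3)[OF ab(2)]
      by simp
  qed (use assms r in \<open>simp_all add: pull_def\<close>)
qed

text \<open>Being a singleton is not atomic information (a fusion can turn a pair into a singleton); one
  further move, made with a second variable \<open>Z\<close>, detects it.\<close>

lemma eqv_singleton:
  assumes G: "tgraph G" and H: "tgraph H" and e: "eqv W M (Suc k) G S H T"
    and XZ: "X \<in> W" "Z \<in> W" "X \<noteq> Z" and T: "T X \<subseteq> ind_dom H" and S: "is_singleton (S X)"
  shows "is_singleton (T X)"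
proof -
  obtain a where a: "S X = {a}" using S by (auto simp: is_singleton_def)
  have lit: "holds G S' l \<longleftrightarrow> holds H T' l"
    if "eqv W M k' G S' H T'" "l \<in> literals W M (rank G)" for k' S' T' l
    using eqv_agree[OF that(1)] that(2) by (simp add: agree_def)
  \<comment> \<open>No literal speaks of emptiness, but only the empty set consists both of vertices
    alone and of edges alone.\<close>
  have empty: "S' Y = {} \<longleftrightarrow> T' Y = {}" if "eqv W M k' G S' H T'" "Y \<in> W" for k' S' T' Y
    using lit[OF that(1), of "InV Y"] lit[OF that(1), of "InE Y"] that(2)
      tgraphD(4)[OF G] tgraphD(4)[OF H] by auto
  obtain b where b: "b \<in> T X" using empty[OF e XZ(1)] a by blast
  then have "{b} \<in> Pow (ind_dom H)" using T by auto
  \<comment> \<open>The test move \<open>{b}\<close> is made in \<open>H\<close>. Its answer is a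
    nonempty subset of \<open>{a}\<close>, hence \<open>{a}\<close>, and the inclusion of
    \<open>S X\<close> in it forces \<open>T X\<close> into \<open>{b}\<close>. As \<open>X\<close>
    and \<open>Z\<close> differ, \<open>X\<close> keeps its value.\<close>
  then obtain A where A: "eqv W M k G (S(Z := A)) H (T(Z := {b}))"
    using e XZ(2) unfolding eqv.simps rel_set_def by blast
  have "A \<subseteq> {a}" using lit[OF A, of "Sub Z X"] XZ a b by auto
  moreover have "A \<noteq> {}" using empty[OF A XZ(2)] by simp
  ultimately have "A = {a}" by blast
  then have "T X \<subseteq> {b}" using lit[OF A, of "Sub X Z"] XZ a by auto
  then show ?thesis using b by (auto simp: is_singleton_def)
qed

section \<open>From the game to truth of formulas\<close>

fun depth :: "mso \<Rightarrow> nat" where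
  "depth (Neg \<phi>) = depth \<phi>"
| "depth (And \<phi> \<psi>) = max (depth \<phi>) (depth \<psi>)"
| "depth (AllI x \<phi>) = Suc (depth \<phi>)"
| "depth (AllS X \<phi>) = Suc (depth \<phi>)"
| "depth _ = 0"

fun arity :: "mso \<Rightarrow> nat" where
  "arity (Conn y xs) = length xs"
| "arity (Neg \<phi>) = arity \<phi>"
| "arity (And \<phi> \<psi>) = max (arity \<phi>) (arity \<psi>)"
| "arity (AllI x \<phi>) = arity \<phi>"
| "arity (AllS X \<phi>) = arity \<phi>"
| "arity _ = 0"

text \<open>Bound variables count too: a quantifier is played as a move in its own variable, and
  moves exist only for variables in \<open>W\<close>.\<close>

fun vars :: "mso \<Rightarrow> var set" where
  "vars (Vert x) = {Inl x}"
| "vars (Edge x) = {Inl x}"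
| "vars (Eq x y) = {Inl x, Inl y}"
| "vars (Mem X x) = {Inr X, Inl x}"
| "vars (Conn y xs) = insert (Inl y) (Inl ` set xs)"
| "vars (Neg \<phi>) = vars \<phi>"
| "vars (And \<phi> \<psi>) = vars \<phi> \<union> vars \<psi>"
| "vars (AllI x \<phi>) = insert (Inl x) (vars \<phi>)"
| "vars (AllS X \<phi>) = insert (Inr X) (vars \<phi>)"

lemma finite_vars: "finite (vars \<phi>)"
  by (induction \<phi>) auto

definition represents ::
    "mso \<Rightarrow> 'a tgraph \<Rightarrow> (nat \<Rightarrow> 'a) \<Rightarrow> (nat \<Rightarrow> 'a set) \<Rightarrow> (var \<Rightarrow> 'a set) \<Rightarrow> bool" where
  "represents \<phi> G i s S \<longleftrightarrow> (\<forall>X. S X \<subseteq> ind_dom G) \<and>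
     (\<forall>x \<in> free_ind \<phi>. S (Inl x) = {i x}) \<and> (\<forall>X \<in> free_set \<phi>. S (Inr X) = s X)"

text \<open>The strict bound on \<open>depth\<close> keeps one move in reserve, which shows that a
  singleton is answered by a singleton. This test is a side branch, so the same reserve is available
  at every nested quantifier. \<open>Inr Z\<close> carries the test because it differs from every
  \<open>Inl x\<close>; it may occur in \<open>\<phi>\<close>, as the test leaves the main position
  unchanged.\<close>

lemma eqv_sat:
  assumes G: "tgraph G" and H: "tgraph H"
    and "Inr Z \<in> W" "vars \<phi> \<subseteq> W" "arity \<phi> \<le> M" "depth \<phi> < k"
    and "represents \<phi> G i s S" "represents \<phi> H j t T" "eqv W M k G S H T"
  shows "sat G i s \<phi> \<longleftrightarrow> sat H j t \<phi>"
  using assms(4-)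
proof (induction \<phi> arbitrary: k i s S j t T)
  have lit: "holds G S l \<longleftrightarrow> holds H T l" if "eqv W M k G S H T" "l \<in> literals W M (rank G)" for k S T l
    using eqv_agree[OF that(1)] that(2) by (simp add: agree_def)
  {
    case (Vert x)
    then show ?case using lit[OF Vert(6), of "InV (Inl x)"] by (auto simp: represents_def)
  next
    case (Edge x)
    then show ?case using lit[OF Edge(6), of "InE (Inl x)"] by (auto simp: represents_def)
  next
    case (Eq x y)
    then show ?case using lit[OF Eq(6), of "Sub (Inl x) (Inl y)"] by (auto simp: represents_def)
  next
    case (Mem X x)
    then show ?case using lit[OF Mem(6), of "Sub (Inl x) (Inr X)"] by (auto simp: represents_def)
  next
    case (Conn y xs)
    \<comment> \<open>Over singletons, membership position by position is equality of words.\<close>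
    have *: "sat K i s (Conn y xs) \<longleftrightarrow> holds K S (Inc (Inl y) (map Inl xs))"
      if "represents (Conn y xs) K i s S" for K :: "'x tgraph" and i s S
    proof -
      have "list_all2 (\<lambda>v x. v \<in> S (Inl x)) vs xs \<longleftrightarrow> list_all2 (\<lambda>v x. v = i x) vs xs" for vs
        using that by (intro list.rel_cong_simp) (auto simp: represents_def simp_implies_def)
      also have "list_all2 (\<lambda>v x. v = i x) vs xs \<longleftrightarrow> vs = map i xs" for vs
        unfolding list_all2_map2[of "(=)" vs i xs, symmetric] list.rel_eq ..
      finally show ?thesis using that by (auto simp: represents_def list_all2_map2)
    qed
    have "Inc (Inl y) (map Inl xs) \<in> literals W M (rank G)" using Conn by auto
    then show ?case unfolding *[OF Conn(4)] *[OF Conn(5)] by (rule lit[OF Conn(6)])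
  next
    case (Neg \<phi>)
    have "sat G i s \<phi> \<longleftrightarrow> sat H j t \<phi>"
      by (rule Neg.IH) (use Neg.prems in \<open>auto simp: represents_def\<close>)
    then show ?case by simp
  next
    case (And \<phi> \<psi>)
    have "sat G i s \<phi> \<longleftrightarrow> sat H j t \<phi>"
      by (rule And.IH(1)[where k = k]) (use And.prems in \<open>auto simp: represents_def\<close>)
    moreover have "sat G i s \<psi> \<longleftrightarrow> sat H j t \<psi>"
      by (rule And.IH(2)[where k = k]) (use And.prems in \<open>auto simp: represents_def\<close>)
    ultimately show ?case by simp
  next
    case (AllI x \<phi>)
    obtain k' where k: "k = Suc (Suc k')" "depth \<phi> < Suc k'"
      using AllI.prems(3) by (cases k; cases "k - 1") auto
    have x: "Inl x \<in> W" using AllI.prems by simp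
    have step: "sat G (i(x := a)) s \<phi> \<longleftrightarrow> sat H (j(x := b)) t \<phi>"
      if "eqv W M (Suc k') G (S(Inl x := {a})) H (T(Inl x := {b}))" "a \<in> ind_dom G" "b \<in> ind_dom H"
      for a b
      by (rule AllI.IH[OF _ _ k(2) _ _ that(1)])
        (use AllI.prems that in \<open>auto simp: represents_def\<close>)
    have forth: "\<exists>b \<in> ind_dom H. eqv W M (Suc k') G (S(Inl x := {a})) H (T(Inl x := {b}))"
      if a: "a \<in> ind_dom G" for a
    proof -
      have "{a} \<in> Pow (ind_dom G)" using a by simp
      then obtain B where B: "B \<subseteq> ind_dom H" "eqv W M (Suc k') G (S(Inl x := {a})) H (T(Inl x := B))"
        using AllI.prems(6) x unfolding k eqv.simps(2)[of _ _ "Suc k'"] rel_set_def by blast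
      have "is_singleton ((T(Inl x := B)) (Inl x))"
        by (rule eqv_singleton[OF G H B(2) x assms(3)]) (use B in auto)
      then show ?thesis using B by (auto simp: is_singleton_def)
    qed
    have backward: "\<exists>a \<in> ind_dom G. eqv W M (Suc k') G (S(Inl x := {a})) H (T(Inl x := {b}))"
      if b: "b \<in> ind_dom H" for b
    proof -
      have "{b} \<in> Pow (ind_dom H)" using b by simp
      then obtain A where A: "A \<subseteq> ind_dom G" "eqv W M (Suc k') G (S(Inl x := A)) H (T(Inl x := {b}))"
        using AllI.prems(6) x unfolding k eqv.simps(2)[of _ _ "Suc k'"] rel_set_def by blast
      have "is_singleton ((S(Inl x := A)) (Inl x))"
        by (rule eqv_singleton[OF H G eqv_sym[OF A(2)] x assms(3)]) (use A in auto)
      then show ?thesis using A by (auto simp: is_singleton_def)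
    qed
    show ?case unfolding sat.simps using step forth backward by metis
  next
    case (AllS X \<phi>)
    obtain k' where k: "k = Suc k'" "depth \<phi> < k'" using AllS.prems(3) by (cases k) auto
    have X: "Inr X \<in> W" using AllS.prems by simp
    have sub: "A \<subseteq> ind_dom K" if "A \<in> set_dom K" for A and K :: "'x tgraph"
      using that by (auto simp: set_dom_def ind_dom_def)
    have rel: "rel_set (\<lambda>A B. eqv W M k' G (S(Inr X := A)) H (T(Inr X := B)))
        (Pow (ind_dom G)) (Pow (ind_dom H))" using AllS.prems(6) X by (simp add: k)
    \<comment> \<open>The quantifier ranges over unmixed sets; the literals keep the answer to such
      a set within that range.\<close>
    have dom: "A \<in> set_dom G \<longleftrightarrow> B \<in> set_dom H"
      if "eqv W M k' G (S(Inr X := A)) H (T(Inr X := B))" for A B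
      using lit[OF that, of "InV (Inr X)"] lit[OF that, of "InE (Inr X)"] X by (simp add: set_dom_def)
    have step: "sat G i (s(X := A)) \<phi> \<longleftrightarrow> sat H j (t(X := B)) \<phi>"
      if "eqv W M k' G (S(Inr X := A)) H (T(Inr X := B))" "A \<subseteq> ind_dom G" "B \<subseteq> ind_dom H" for A B
      by (rule AllS.IH[OF _ _ k(2) _ _ that(1)])
        (use AllS.prems that in \<open>auto simp: represents_def\<close>)
    show ?case
    proof
      assume l: "sat G i s (AllS X \<phi>)"
      have "sat H j (t(X := B)) \<phi>" if B: "B \<in> set_dom H" for B
      proof -
        obtain A where A: "A \<subseteq> ind_dom G" "eqv W M k' G (S(Inr X := A)) H (T(Inr X := B))"
          using rel sub[OF B] unfolding rel_set_def by blast
        then show ?thesis using l dom[OF A(2)] step[OF A(2,1) sub[OF B]] B by simp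
      qed
      then show "sat H j t (AllS X \<phi>)" by simp
    next
      assume r: "sat H j t (AllS X \<phi>)"
      have "sat G i (s(X := A)) \<phi>" if A: "A \<in> set_dom G" for A
      proof -
        obtain B where B: "B \<subseteq> ind_dom H" "eqv W M k' G (S(Inr X := A)) H (T(Inr X := B))"
          using rel sub[OF A] unfolding rel_set_def by blast
        then show ?thesis using r dom[OF B(2)] step[OF B(2) sub[OF A] B(1)] A by simp
      qed
      then show "sat G i s (AllS X \<phi>)" by simp
    qed
  }
qed

lemma eqv_models:
  assumes "tgraph G" "tgraph H" "sentence \<phi>" "insert (Inr 0) (vars \<phi>) \<subseteq> W"
    and "eqv W (arity \<phi>) (Suc (depth \<phi>)) G (\<lambda>_. {}) H (\<lambda>_. {})"
  shows "models G \<phi> \<longleftrightarrow> models H \<phi>"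
proof -
  \<comment> \<open>\<open>models\<close> quantifies over all assignments and would be vacuous if
    there were none; a vertex provides one.\<close>
  have ex: "\<exists>i s. range i \<subseteq> ind_dom K \<and> range s \<subseteq> set_dom K" if K: "tgraph K" for K :: "'x tgraph"
  proof -
    obtain v where "v \<in> verts K" using tgraphD(2)[OF K] by blast
    then show ?thesis
      by (intro exI[of _ "\<lambda>_. v"] exI[of _ "\<lambda>_. {}"]) (auto simp: ind_dom_def set_dom_def)
  qed
  \<comment> \<open>Only free variables tie \<open>S\<close> to \<open>i\<close> and
    \<open>s\<close>. A sentence has none, so the empty sets represent all assignments in both
    graphs.\<close>
  have rep: "represents \<phi> K i s (\<lambda>_. {})" for K :: "'x tgraph" and i s
    using assms(3) by (simp add: represents_def sentence_def)
  have "sat G i s \<phi> \<longleftrightarrow> sat H j t \<phi>" for i s j t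
    by (rule eqv_sat[OF assms(1,2) _ _ _ _ rep rep assms(5)]) (use assms(4) in auto)
  then show ?thesis using ex[OF assms(1)] ex[OF assms(2)] unfolding models_def by meson
qed

section \<open>Recognisability from a congruence of finite index\<close>

text \<open>The colour of any member determines its class, so there are at most as many classes as
  colours.\<close>

lemma finite_quotient_of_colouring:
  assumes "equiv A r" "finite (c ` A)" "\<And>x y. x \<in> A \<Longrightarrow> y \<in> A \<Longrightarrow> c x = c y \<Longrightarrow> (x, y) \<in> r"
  shows "finite (A // r)"
proof -
  have "A // r \<subseteq> (\<lambda>n. r `` {SOME x. x \<in> A \<and> c x = n}) ` c ` A"
  proof
    fix C assume "C \<in> A // r"
    then obtain x where x: "x \<in> A" "C = r `` {x}" by (auto elim: quotientE)
    define y where "y = (SOME y. y \<in> A \<and> c y = c x)"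
    have "y \<in> A \<and> c y = c x" unfolding y_def by (rule someI[of _ x]) (simp add: x)
    then have "C = r `` {y}" using x assms(1,3) by (metis equiv_class_eq)
    then show "C \<in> (\<lambda>n. r `` {SOME x. x \<in> A \<and> c x = n}) ` c ` A" using x by (auto simp: y_def)
  qed
  then show ?thesis using assms(2) finite_subset by blast
qed

text \<open>The quotient algebra recognises \<open>L\<close>: operations act on chosen
  representatives, the congruence makes the choice irrelevant, and \<open>L\<close> is a union of
  classes, hence the preimage of its image.\<close>

lemma recognisable_of_congruence:
  fixes A :: "('s, 'f, 'a) algebra"
  assumes A: "algebra S A"
    and eq: "\<And>t. t \<in> sorts S \<Longrightarrow> equiv (carrier A t) (r t)"
    and fin: "\<And>t. t \<in> sorts S \<Longrightarrow> finite (carrier A t // r t)"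
    and cong: "\<And>f xs ys. f \<in> funs S \<Longrightarrow> xs \<in> args S A f \<Longrightarrow> ys \<in> args S A f \<Longrightarrow>
      (\<And>i. i < length (dom_sorts S f) \<Longrightarrow> (xs ! i, ys ! i) \<in> r (dom_sorts S f ! i)) \<Longrightarrow>
      (opn A f xs, opn A f ys) \<in> r (cod_sort S f)"
    and t: "t \<in> sorts S" and L: "L \<subseteq> carrier A t" "\<And>x y. (x, y) \<in> r t \<Longrightarrow> x \<in> L \<Longrightarrow> y \<in> L"
  shows "recognisable S A t L"
proof -
  define sel :: "'s \<Rightarrow> 'a set \<Rightarrow> 'a" where "sel u C = (SOME x. x \<in> C)" for u C
  define B :: "('s, 'f, 'a set) algebra" where
    "B = \<lparr>carrier = (\<lambda>u. carrier A u // r u),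
          opn = (\<lambda>f Cs. r (cod_sort S f) `` {opn A f (map2 sel (dom_sorts S f) Cs)})\<rparr>"
  define h where "h u x = r u `` {x}" for u x
  have S: "set (dom_sorts S f) \<subseteq> sorts S" "cod_sort S f \<in> sorts S" if "f \<in> funs S" for f
    using A that by (auto simp: algebra_def signature_def)
  have opA: "opn A f xs \<in> carrier A (cod_sort S f)" if "f \<in> funs S" "xs \<in> args S A f" for f xs
    using A that by (auto simp: algebra_def)
  have sel_in: "sel u C \<in> C" "C \<subseteq> carrier A u" if "u \<in> sorts S" "C \<in> carrier A u // r u" for u C
  proof -
    have "C \<noteq> {}" using in_quotient_imp_non_empty[OF eq that(2)] that(1) by blast
    then show "sel u C \<in> C" by (simp add: sel_def some_in_eq)
    show "C \<subseteq> carrier A u" using in_quotient_imp_subset[OF eq that(2)] that(1) by blast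
  qed
  have sel_args: "map2 sel (dom_sorts S f) Cs \<in> args S A f" if f: "f \<in> funs S" and Cs: "Cs \<in> args S B f" for f Cs
  proof -
    have C: "length Cs = length (dom_sorts S f)"
      "\<And>i. i < length Cs \<Longrightarrow> Cs ! i \<in> carrier A (dom_sorts S f ! i) // r (dom_sorts S f ! i)"
      using Cs by (simp_all add: args_def list_all2_conv_all_nth B_def)
    have "dom_sorts S f ! i \<in> sorts S" if "i < length Cs" for i
      using S(1)[OF f] C(1) that by auto
    then show ?thesis using C sel_in by (simp add: args_def list_all2_conv_all_nth) blast
  qed
  show ?thesis
  proof (rule recognisableI[OF A _ _ _ t])
    show "algebra S B"
    proof -
      \<comment> \<open>A class common to two carriers would be nonempty and so put an element into
        two disjoint carriers of \<open>A\<close>.\<close>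
      have "carrier B u \<inter> carrier B v = {}" if "u \<in> sorts S" "v \<in> sorts S" "u \<noteq> v" for u v
      proof (rule equals0I)
        fix C assume "C \<in> carrier B u \<inter> carrier B v"
        then have "C \<in> carrier A u // r u" "C \<in> carrier A v // r v" by (auto simp: B_def)
        then have "sel u C \<in> carrier A u" "sel u C \<in> carrier A v"
          using sel_in[OF that(1)] sel_in[OF that(2)] by blast+
        then show False using A that by (auto simp: algebra_def)
      qed
      moreover have "opn B f Cs \<in> carrier B (cod_sort S f)" if "f \<in> funs S" "Cs \<in> args S B f" for f Cs
        using opA[OF that(1) sel_args[OF that]] by (simp add: B_def quotientI)
      ultimately show ?thesis using A by (auto simp: algebra_def)
    qed
    show "locally_finite S B" using fin by (simp add: locally_finite_def B_def)
    show "morphism S A B h"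
    proof -
      have "h (cod_sort S f) (opn A f xs) = opn B f (map2 h (dom_sorts S f) xs)"
        if f: "f \<in> funs S" and xs: "xs \<in> args S A f" for f xs
      proof -
        let ?ys = "map2 sel (dom_sorts S f) (map2 h (dom_sorts S f) xs)"
        have x: "length xs = length (dom_sorts S f)"
          "\<And>i. i < length xs \<Longrightarrow> xs ! i \<in> carrier A (dom_sorts S f ! i)"
          using xs by (auto simp: args_def list_all2_conv_all_nth)
        have s: "dom_sorts S f ! i \<in> sorts S" if "i < length xs" for i
          using S(1)[OF f] x(1) that by auto
        have "map2 h (dom_sorts S f) xs \<in> args S B f"
          using x by (simp add: args_def list_all2_conv_all_nth B_def h_def quotientI)
        then have ys: "?ys \<in> args S A f" by (rule sel_args[OF f])
        have "(xs ! i, ?ys ! i) \<in> r (dom_sorts S f ! i)" if "i < length (dom_sorts S f)" for i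
        proof -
          have "sel (dom_sorts S f ! i) (h (dom_sorts S f ! i) (xs ! i)) \<in> h (dom_sorts S f ! i) (xs ! i)"
            using that x s by (intro sel_in) (simp_all add: h_def quotientI)
          then show ?thesis using that x(1) by (simp add: h_def)
        qed
        then have "(opn A f xs, opn A f ?ys) \<in> r (cod_sort S f)" using cong[OF f xs ys] by blast
        then show ?thesis using equiv_class_eq[OF eq[OF S(2)[OF f]]] by (simp add: B_def h_def)
      qed
      then show ?thesis by (simp add: morphism_def B_def h_def quotientI)
    qed
    show "h t ` L \<subseteq> carrier B t" using L(1) by (auto simp: B_def h_def quotientI)
    show "L = {x \<in> carrier A t. h t x \<in> h t ` L}"
    proof -
      have "x \<in> L" if "x \<in> carrier A t" "y \<in> L" "h t x = h t y" for x y
      proof -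
        have "(y, x) \<in> r t" using that eq_equiv_class_iff[OF eq[OF t], of y x] L(1) by (auto simp: h_def)
        then show ?thesis using L(2) that(2) by blast
      qed
      then show ?thesis using L(1) by blast
    qed
  qed
qed

section \<open>The congruence on isomorphism classes\<close>

definition class_eqv :: "var set \<Rightarrow> nat \<Rightarrow> nat \<Rightarrow> nat \<Rightarrow> (agraph \<times> agraph) set" where
  "class_eqv W M k n = {(X, Y). X \<in> agraphs n \<and> Y \<in> agraphs n \<and>
     (\<forall>G \<in> X. \<forall>H \<in> Y. eqv W M k G (\<lambda>_. {}) H (\<lambda>_. {}))}"

text \<open>Invariance under isomorphism and transitivity let one pair of representatives stand for
  all. They may live over any type, as \<open>disj_sum\<close> yields graphs over a sum
  type.\<close>

lemma class_eqv_iff: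
  assumes "tgraph G" "tgraph H" "rank G = n" "rank H = n"
  shows "(iso_class G, iso_class H) \<in> class_eqv W M k n \<longleftrightarrow> eqv W M k G (\<lambda>_. {}) H (\<lambda>_. {})"
proof
  assume *: "(iso_class G, iso_class H) \<in> class_eqv W M k n"
  obtain G' :: "nat tgraph" where G': "tgraph G'" "iso G G'" using ex_nat_copy[OF assms(1)] by blast
  obtain H' :: "nat tgraph" where H': "tgraph H'" "iso H H'" using ex_nat_copy[OF assms(2)] by blast
  have "eqv W M k G' (\<lambda>_. {}) H' (\<lambda>_. {})" using * G' H' by (auto simp: class_eqv_def iso_class_def)
  then show "eqv W M k G (\<lambda>_. {}) H (\<lambda>_. {})"
    by (rule eqv_trans[OF eqv_trans[OF eqv_iso[OF assms(1) G']] eqv_sym[OF eqv_iso[OF assms(2) H']]])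
next
  assume e: "eqv W M k G (\<lambda>_. {}) H (\<lambda>_. {})"
  have "eqv W M k G' (\<lambda>_. {}) H' (\<lambda>_. {})" if "G' \<in> iso_class G" "H' \<in> iso_class H" for G' H'
  proof -
    have "tgraph G'" "iso G G'" "tgraph H'" "iso H H'" using that by (auto simp: iso_class_def)
    then show ?thesis
      using eqv_trans[OF eqv_trans[OF eqv_sym[OF eqv_iso[OF assms(1)]] e] eqv_iso[OF assms(2)]] by blast
  qed
  then show "(iso_class G, iso_class H) \<in> class_eqv W M k n"
    using assms by (simp add: class_eqv_def iso_class_in_agraphs)
qed

lemma agraphsE:
  assumes "X \<in> agraphs n"
  obtains G :: "nat tgraph" where "tgraph G" "rank G = n" "X = iso_class G"
  using assms by (auto simp: agraphs_def)

lemma equiv_class_eqv: "equiv (agraphs n) (class_eqv W M k n)"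
proof (rule equivI)
  show "class_eqv W M k n \<subseteq> agraphs n \<times> agraphs n" by (auto simp: class_eqv_def)
  show "refl_on (agraphs n) (class_eqv W M k n)"
    by (rule refl_onI) (auto elim!: agraphsE simp: class_eqv_iff eqv_refl)
  show "sym (class_eqv W M k n)"
    by (auto simp: sym_def class_eqv_def intro: eqv_sym)
  show "trans (class_eqv W M k n)"
  proof (rule transI)
    fix X Y Z assume *: "(X, Y) \<in> class_eqv W M k n" "(Y, Z) \<in> class_eqv W M k n"
    then obtain G H K :: "nat tgraph" where "tgraph G" "rank G = n" "X = iso_class G"
      "tgraph H" "rank H = n" "Y = iso_class H" "tgraph K" "rank K = n" "Z = iso_class K"
      unfolding class_eqv_def by (auto elim!: agraphsE)
    then show "(X, Z) \<in> class_eqv W M k n" using * by (auto simp: class_eqv_iff intro: eqv_trans)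
  qed
qed

lemma finite_class_eqv:
  assumes "finite W"
  shows "finite (agraphs n // class_eqv W M k n)"
proof -
  obtain c :: "nat tgraph \<Rightarrow> (var \<Rightarrow> nat set) \<Rightarrow> nat" where c: "finite {c G S |G S. rank G = n}"
    "\<And>G S H T. rank G = n \<Longrightarrow> rank H = n \<Longrightarrow> c G S = c H T \<Longrightarrow> eqv W M k G S H T"
    using eqv_finite_index[OF assms, of n M k] by blast
  have "\<forall>X \<in> agraphs n. \<exists>G :: nat tgraph. tgraph G \<and> rank G = n \<and> X = iso_class G"
    by (auto simp: agraphs_def)
  then obtain rep :: "agraph \<Rightarrow> nat tgraph"
    where rep: "\<forall>X \<in> agraphs n. tgraph (rep X) \<and> rank (rep X) = n \<and> X = iso_class (rep X)"
    by (rule bchoice[THEN exE])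
  show ?thesis
  proof (rule finite_quotient_of_colouring[OF equiv_class_eqv, where c = "\<lambda>X. c (rep X) (\<lambda>_. {})"])
    have "(\<lambda>X. c (rep X) (\<lambda>_. {})) ` agraphs n \<subseteq> {c G S |G S. rank G = n}" using rep by blast
    then show "finite ((\<lambda>X. c (rep X) (\<lambda>_. {})) ` agraphs n)" using c(1) finite_subset by blast
    show "(X, Y) \<in> class_eqv W M k n" if "X \<in> agraphs n" "Y \<in> agraphs n"
      "c (rep X) (\<lambda>_. {}) = c (rep Y) (\<lambda>_. {})" for X Y
    proof -
      have *: "tgraph (rep Z) \<and> rank (rep Z) = n" "iso_class (rep Z) = Z" if "Z \<in> agraphs n" for Z
        using rep that by auto
      have "eqv W M k (rep X) (\<lambda>_. {}) (rep Y) (\<lambda>_. {})"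
        by (rule c(2)[OF _ _ that(3)]) (use *(1) that in blast)+
      then have "(iso_class (rep X), iso_class (rep Y)) \<in> class_eqv W M k n"
        using class_eqv_iff[of "rep X" "rep Y" n W M k] *(1)[OF that(1)] *(1)[OF that(2)] by simp
      then show ?thesis by (simp only: *(2)[OF that(1)] *(2)[OF that(2)])
    qed
  qed
qed

lemma class_eqv_gop:
  assumes f: "f \<in> funs graph_sig" and xs: "xs \<in> args graph_sig graph_alg f"
    and ys: "ys \<in> args graph_sig graph_alg f"
    and e: "\<And>i. i < length (dom_sorts graph_sig f) \<Longrightarrow>
      (xs ! i, ys ! i) \<in> class_eqv W M k (dom_sorts graph_sig f ! i)"
  shows "(gop f xs, gop f ys) \<in> class_eqv W M k (cod_sort graph_sig f)"
proof (cases f)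
  case (Sum n m)
  obtain X Y where X: "xs = [X, Y]" "X \<in> agraphs n" "Y \<in> agraphs m"
    using xs Sum by (auto simp: args_def graph_sig_def graph_alg_def list_all2_Cons2)
  obtain X' Y' where X': "ys = [X', Y']" "X' \<in> agraphs n" "Y' \<in> agraphs m"
    using ys Sum by (auto simp: args_def graph_sig_def graph_alg_def list_all2_Cons2)
  have e': "(X, X') \<in> class_eqv W M k n" "(Y, Y') \<in> class_eqv W M k m"
    using e[of 0] e[of 1] X(1) X'(1) Sum by (simp_all add: graph_sig_def)
  obtain G H G' H' :: "nat tgraph" where GH: "tgraph G" "rank G = n" "X = iso_class G"
      "tgraph H" "rank H = m" "Y = iso_class H" "tgraph G'" "rank G' = n" "X' = iso_class G'"
      "tgraph H'" "rank H' = m" "Y' = iso_class H'"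
    using X X' by (auto elim!: agraphsE)
  \<comment> \<open>Empty sets are written as sums of empty sets to match
    \<open>eqv_disj_sum\<close>.\<close>
  then have "eqv W M k (disj_sum G H) (\<lambda>_. {} <+> {}) (disj_sum G' H') (\<lambda>_. {} <+> {})"
    using e' by (intro eqv_disj_sum) (auto simp: class_eqv_iff)
  then have "eqv W M k (disj_sum G H) (\<lambda>_. {}) (disj_sum G' H') (\<lambda>_. {})" by (simp add: Plus_def)
  then show ?thesis using GH X X' Sum
    by (simp add: gop_iso_class graph_sig_def class_eqv_iff tgraph_disj_sum del: gop.simps)
next
  case (Redef n m \<sigma>)
  have \<sigma>: "\<sigma> \<in> {1..n} \<rightarrow> {1..m}" using f Redef by (auto simp: graph_sig_def PiE_def)
  obtain G H :: "nat tgraph" where GH: "xs = [iso_class G]" "tgraph G" "rank G = m"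
      "ys = [iso_class H]" "tgraph H" "rank H = m"
    using xs ys Redef by (auto simp: args_def graph_sig_def graph_alg_def list_all2_Cons2 agraphs_def)
  then have "eqv W M k G (\<lambda>_. {}) H (\<lambda>_. {})"
    using e[of 0] Redef by (simp add: graph_sig_def class_eqv_iff)
  then have "eqv W M k (redefine n \<sigma> G) (\<lambda>_. {}) (redefine n \<sigma> H) (\<lambda>_. {})"
    using GH \<sigma> by (intro eqv_redefine) auto
  then show ?thesis using GH \<sigma> Redef
    by (simp add: gop_iso_class graph_sig_def class_eqv_iff tgraph_redefine del: gop.simps)
next
  case (Fuse n a b)
  have ab: "a \<in> {1..n}" "b \<in> {1..n}" using f Fuse by (auto simp: graph_sig_def)
  obtain G H :: "nat tgraph" where GH: "xs = [iso_class G]" "tgraph G" "rank G = n"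
      "ys = [iso_class H]" "tgraph H" "rank H = n"
    using xs ys Fuse by (auto simp: args_def graph_sig_def graph_alg_def list_all2_Cons2 agraphs_def)
  then have "eqv W M k G (\<lambda>_. {}) H (\<lambda>_. {})"
    using e[of 0] Fuse by (simp add: graph_sig_def class_eqv_iff)
  then have "eqv W M k (fuse a b G) (\<lambda>_. {}) (fuse a b H) (\<lambda>_. {})"
    using GH ab by (intro eqv_fuse) auto
  then show ?thesis using GH ab Fuse
    by (simp add: gop_iso_class graph_sig_def class_eqv_iff tgraph_fuse del: gop.simps)
next
  case VertC
  then show ?thesis using xs ys
    by (simp add: args_def graph_sig_def class_eqv_iff eqv_refl tgraph_vertex_graph)
next
  case (EdgeC n)
  then show ?thesis using xs ys f
    by (simp add: args_def graph_sig_def class_eqv_iff eqv_refl tgraph_edge_graph)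
qed

theorem theorem7p1p1:
  fixes \<phi> :: mso and n :: nat
  assumes "sentence \<phi>"
  shows "recognisable graph_sig graph_alg n {G \<in> agraphs n. amodels G \<phi>}"
proof -
  \<comment> \<open>\<open>Inr 0\<close> provides a variable for the singleton test even if
    \<open>\<phi>\<close> contains no set variable.\<close>
  define W where "W = insert (Inr 0) (vars \<phi>)"
  \<comment> \<open>The parameters depend on \<open>\<phi>\<close> alone, so one congruence covers
    all sorts; the successor is the reserved move.\<close>
  let ?r = "class_eqv W (arity \<phi>) (Suc (depth \<phi>))"
  have "finite W" by (simp add: W_def finite_vars)
  show ?thesis
  proof (rule recognisable_of_congruence[OF algebra_graph_alg, where r = ?r])
    show "equiv (carrier graph_alg t) (?r t)" "finite (carrier graph_alg t // ?r t)" for t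
      using equiv_class_eqv finite_class_eqv[OF \<open>finite W\<close>] by (simp_all add: graph_alg_def)
    show "(opn graph_alg f xs, opn graph_alg f ys) \<in> ?r (cod_sort graph_sig f)"
      if "f \<in> funs graph_sig" "xs \<in> args graph_sig graph_alg f" "ys \<in> args graph_sig graph_alg f"
        "\<And>i. i < length (dom_sorts graph_sig f) \<Longrightarrow> (xs ! i, ys ! i) \<in> ?r (dom_sorts graph_sig f ! i)"
      for f xs ys
      using class_eqv_gop[OF that] by (simp add: graph_alg_def)
    show "n \<in> sorts graph_sig" by (simp add: graph_sig_def)
    show "{G \<in> agraphs n. amodels G \<phi>} \<subseteq> carrier graph_alg n" by (auto simp: graph_alg_def)
    fix X Y assume XY: "(X, Y) \<in> ?r n" "X \<in> {G \<in> agraphs n. amodels G \<phi>}"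
    then obtain G H :: "nat tgraph" where GH: "tgraph G" "rank G = n" "X = iso_class G"
        "tgraph H" "rank H = n" "Y = iso_class H"
      by (auto simp: class_eqv_def elim!: agraphsE)
    then have "eqv W (arity \<phi>) (Suc (depth \<phi>)) G (\<lambda>_. {}) H (\<lambda>_. {})"
      using XY(1) by (simp add: class_eqv_iff del: eqv.simps)
    then have "models G \<phi> \<longleftrightarrow> models H \<phi>"
      using eqv_models[OF GH(1,4) assms, of W] by (simp add: W_def del: eqv.simps)
    then show "Y \<in> {G \<in> agraphs n. amodels G \<phi>}"
      using XY GH by (simp add: amodels_iso_class iso_class_in_agraphs)
  qed
qed

end
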